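(* Let $G$ be a finitely generated acylindrically hyperbolic group whose outer automorphism group $\mathrm{Out}(G)$ is infinite. For any sequence $[\phi_1],[\phi_2],\dots$ in $\mathrm{Out}(G)$ with $[\phi_i]\neq[\phi_j]$ for $i\ne j$, there exist automorphism representatives $\phi_1,\phi_2,\dots\in\mathrm{Aut}(G)$ such that the kernels of the natural action on an asymptotic cone and of Paulin's construction coincide, that is, $$\ker\left(G \curvearrowright \mathrm{Cone}_{\omega}(G,d_n)\right) = \ker\left(G \overset{p}{\curvearrowright} \mathrm{Cone}_{\omega}(G)\right)$$ for every non-principal ultrafilter $\omega$ on $\mathbb{N}$ and every unbounded non-decreasing sequence $(d_n)$ of positive reals.
   Context: Asymptotic cones. Let $G$ be a finitely generated group with finite generating set $S$ and word length $\|\cdot\|_S$, $\omega$ a non-principal ultrafilter on $\mathbb{N}$, and $(d_n)$ an unbounded non-decreasing sequence of positive reals. $\mathrm{Cone}_\omega(G,d_n)$ is the ultralimit of $(\Gamma(G,S), \frac{1}{d_n}d_S, e)$; its points are represented by sequences $\{x_n\}$ in $G$ with $\|x_n\|_S/d_n$ bounded (admissible sequences), where $\{x_n\}=\{y_n\}$ iff $\lim_\omega \|x_n^{-1}y_n\|_S/d_n=0$. $G$ acts isometrically by $g\cdot\{x_n\}=\{gx_n\}$ (the natural action). The kernel is the set of $g \in G$ with $\lim_\omega \|x_n^{-1}gx_n\|_S/d_n=0$ for all admissible $\{x_n\}$. Paulin's construction. Fix a finite generating set $S$ of $G$ with word metric $d_S$. Given automorphisms $\phi_n$ representing pairwise distinct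 elements of $\mathrm{Out}(G)$, put $$\lambda_n := \inf_{g\in G}\max_{s\in S} d_S(g,\phi_n(s)g)$$ (this depends only on $[\phi_n]$, and $\lambda_n\to\infty$). $\mathrm{Cone}_\omega(G)$ denotes the asymptotic cone of $G$ with scaling sequence $\lambda_n$, that is, the ultralimit of $(\Gamma(G,S), \frac{1}{\lambda_n}d_S, e)$, where $\Gamma(G,S)$ is the Cayley graph; its points are represented by sequences $\{x_n\}$ in $G$ with $\|x_n\|_S/\lambda_n$ bounded (admissible sequences), where $\{x_n\}=\{y_n\}$ iff $\lim_\omega \|x_n^{-1}y_n\|_S/\lambda_n=0$. $G\overset{p}{\curvearrowright}\mathrm{Cone}_\omega(G)$ is the twisted action $g\cdot\{x_n\}=\{\phi_n(g)x_n\}$ (the representatives $\phi_n$ being such that this carries admissible sequences to admissible sequences). Acylindrical hyperbolicity. A $\delta$-hyperbolic space is a geodesic metric space with uniformly thin geodesic triangles. An isometric action of $G$ on a metric space $X$ is acylindrical if for every $\epsilon>0$ there are $R,N>0$ such that $|\{g\in G: d(x,gx)\le\epsilon, d(y,gy)\le\epsilon\}|\le N$ whenever $d(x,y)\ge R$. An action on a $\delta$-hyperbolic space $X$ is non-elementary if the limit set of $G$ in the Gromov boundary $\partial X$ has more than 2 points. $G$ is acylindrically hyperbolic if it admits a non-elementary acylindrical isometric action on some $\delta$-hyperbolic space. *)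

theory Defs
  imports "HOL-Analysis.Analysis" "HOL-Algebra.Algebra"
begin

section \<open>Acylindrically hyperbolic groups\<close>

definition geodesic_segment :: "'x set \<Rightarrow> ('x \<Rightarrow> 'x \<Rightarrow> real) \<Rightarrow> 'x \<Rightarrow> 'x \<Rightarrow> 'x set \<Rightarrow> bool" where
  "geodesic_segment M d x y I \<longleftrightarrow>
     (\<exists>\<gamma>. \<gamma> ` {0..d x y} = I \<and> I \<subseteq> M \<and> \<gamma> 0 = x \<and> \<gamma> (d x y) = y \<and>
          (\<forall>s\<in>{0..d x y}. \<forall>t\<in>{0..d x y}. d (\<gamma> s) (\<gamma> t) = \<bar>s - t\<bar>))"

definition hyperbolic_space :: "'x set \<Rightarrow> ('x \<Rightarrow> 'x \<Rightarrow> real) \<Rightarrow> real \<Rightarrow> bool" where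
  "hyperbolic_space M d \<delta> \<longleftrightarrow>
     Metric_space M d \<and>
     (\<forall>x\<in>M. \<forall>y\<in>M. \<exists>I. geodesic_segment M d x y I) \<and>
     (\<forall>x\<in>M. \<forall>y\<in>M. \<forall>z\<in>M. \<forall>I J K.
        geodesic_segment M d x y I \<and> geodesic_segment M d y z J \<and> geodesic_segment M d z x K
        \<longrightarrow> (\<forall>p\<in>I. \<exists>q\<in>J \<union> K. d p q \<le> \<delta>))"

definition gromov_product :: "('x \<Rightarrow> 'x \<Rightarrow> real) \<Rightarrow> 'x \<Rightarrow> 'x \<Rightarrow> 'x \<Rightarrow> real" where
  "gromov_product d b x y = (d x b + d y b - d x y) / 2"

text \<open>
  The space need not be proper, so boundary points are classes of sequences converging to infinity.
  The condition below does not depend on the base point.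
\<close>
definition gromov_rel :: "'x set \<Rightarrow> ('x \<Rightarrow> 'x \<Rightarrow> real) \<Rightarrow> ((nat \<Rightarrow> 'x) \<times> (nat \<Rightarrow> 'x)) set" where
  "gromov_rel M d =
     {(u, v). range u \<subseteq> M \<and> range v \<subseteq> M \<and>
        (\<forall>b\<in>M. filterlim (\<lambda>(i, j). gromov_product d b (u i) (v j)) at_top
                  (sequentially \<times>\<^sub>F sequentially))}"

definition gromov_sequences :: "'x set \<Rightarrow> ('x \<Rightarrow> 'x \<Rightarrow> real) \<Rightarrow> (nat \<Rightarrow> 'x) set" where
  "gromov_sequences M d = {u. (u, u) \<in> gromov_rel M d}"

definition gromov_boundary :: "'x set \<Rightarrow> ('x \<Rightarrow> 'x \<Rightarrow> real) \<Rightarrow> (nat \<Rightarrow> 'x) set set" where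
  "gromov_boundary M d =
     gromov_sequences M d // (gromov_rel M d \<inter> gromov_sequences M d \<times> gromov_sequences M d)"

text \<open>
  A sequence of points converges to the boundary point \<open>\<xi>\<close> iff it is one of the sequences in the
  class \<open>\<xi>\<close>, so these are the accumulation points in the boundary of an orbit. They do not depend
  on the chosen orbit.
\<close>
definition limit_set ::
  "('g, 'b) monoid_scheme \<Rightarrow> 'x set \<Rightarrow> ('x \<Rightarrow> 'x \<Rightarrow> real) \<Rightarrow> ('g \<Rightarrow> 'x \<Rightarrow> 'x) \<Rightarrow> (nat \<Rightarrow> 'x) set set" where
  "limit_set G M d \<alpha> =
     {\<xi> \<in> gromov_boundary M d. \<exists>p\<in>M. \<exists>u\<in>\<xi>. range u \<subseteq> orbit G \<alpha> p}"

definition isometric_action ::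
  "('g, 'b) monoid_scheme \<Rightarrow> 'x set \<Rightarrow> ('x \<Rightarrow> 'x \<Rightarrow> real) \<Rightarrow> ('g \<Rightarrow> 'x \<Rightarrow> 'x) \<Rightarrow> bool" where
  "isometric_action G M d \<alpha> \<longleftrightarrow>
     Metric_space M d \<and> group_action G M \<alpha> \<and>
     (\<forall>g\<in>carrier G. \<forall>x\<in>M. \<forall>y\<in>M. d (\<alpha> g x) (\<alpha> g y) = d x y)"

definition acylindrical ::
  "('g, 'b) monoid_scheme \<Rightarrow> 'x set \<Rightarrow> ('x \<Rightarrow> 'x \<Rightarrow> real) \<Rightarrow> ('g \<Rightarrow> 'x \<Rightarrow> 'x) \<Rightarrow> bool" where
  "acylindrical G M d \<alpha> \<longleftrightarrow>
     (\<forall>\<epsilon>>0. \<exists>R>0. \<exists>N>0. \<forall>x\<in>M. \<forall>y\<in>M. R \<le> d x y \<longrightarrow>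
        finite {g \<in> carrier G. d x (\<alpha> g x) \<le> \<epsilon> \<and> d y (\<alpha> g y) \<le> \<epsilon>} \<and>
        card {g \<in> carrier G. d x (\<alpha> g x) \<le> \<epsilon> \<and> d y (\<alpha> g y) \<le> \<epsilon>} \<le> N)"

definition non_elementary ::
  "('g, 'b) monoid_scheme \<Rightarrow> 'x set \<Rightarrow> ('x \<Rightarrow> 'x \<Rightarrow> real) \<Rightarrow> ('g \<Rightarrow> 'x \<Rightarrow> 'x) \<Rightarrow> bool" where
  "non_elementary G M d \<alpha> \<longleftrightarrow> infinite (limit_set G M d \<alpha>) \<or> card (limit_set G M d \<alpha>) > 2"

text \<open>
  HOL cannot quantify existentially over types, so the type \<open>'x\<close> of points of the hyperbolic space
  is a parameter. When this is the hypothesis of a theorem in which \<open>'x\<close> is a free type variable,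
  the space is allowed to live on any type.
\<close>
definition acylindrically_hyperbolic :: "'x itself \<Rightarrow> ('g, 'b) monoid_scheme \<Rightarrow> bool" where
  "acylindrically_hyperbolic (T :: 'x itself) G \<longleftrightarrow>
     (\<exists>(M :: 'x set) d \<delta> \<alpha>. hyperbolic_space M d \<delta> \<and> isometric_action G M d \<alpha> \<and>
        acylindrical G M d \<alpha> \<and> non_elementary G M d \<alpha>)"


section \<open>Outer automorphisms\<close>

definition Inn :: "('a, 'b) monoid_scheme \<Rightarrow> ('a \<Rightarrow> 'a) set" where
  "Inn G = {\<lambda>x\<in>carrier G. h \<otimes>\<^bsub>G\<^esub> x \<otimes>\<^bsub>G\<^esub> inv\<^bsub>G\<^esub> h | h. h \<in> carrier G}"

definition Out :: "('a, 'b) monoid_scheme \<Rightarrow> ('a \<Rightarrow> 'a) set monoid" where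
  "Out G = AutoGroup G Mod Inn G"

definition out_class :: "('a, 'b) monoid_scheme \<Rightarrow> ('a \<Rightarrow> 'a) \<Rightarrow> ('a \<Rightarrow> 'a) set" where
  "out_class G \<phi> = Inn G #>\<^bsub>AutoGroup G\<^esub> \<phi>"


section \<open>Asymptotic cones\<close>

definition word_length :: "('a, 'b) monoid_scheme \<Rightarrow> 'a set \<Rightarrow> 'a \<Rightarrow> nat" where
  "word_length G S g =
     (LEAST n. \<exists>w. length w = n \<and> set w \<subseteq> S \<union> m_inv G ` S \<and> foldr (mult G) w \<one>\<^bsub>G\<^esub> = g)"

definition word_dist :: "('a, 'b) monoid_scheme \<Rightarrow> 'a set \<Rightarrow> 'a \<Rightarrow> 'a \<Rightarrow> real" where
  "word_dist G S x y = real (word_length G S (inv\<^bsub>G\<^esub> x \<otimes>\<^bsub>G\<^esub> y))"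

definition nonprincipal_ultrafilter :: "'i filter \<Rightarrow> bool" where
  "nonprincipal_ultrafilter \<omega> \<longleftrightarrow>
     \<omega> \<noteq> bot \<and> (\<forall>P. eventually P \<omega> \<or> eventually (\<lambda>i. \<not> P i) \<omega>) \<and> (\<forall>i. \<omega> \<noteq> principal {i})"

definition admissible ::
  "('a, 'b) monoid_scheme \<Rightarrow> 'a set \<Rightarrow> (nat \<Rightarrow> real) \<Rightarrow> (nat \<Rightarrow> 'a) set" where
  "admissible G S d =
     {x. range x \<subseteq> carrier G \<and> (\<exists>C. \<forall>n. real (word_length G S (x n)) / d n \<le> C)}"

definition cone_rel ::
  "('a, 'b) monoid_scheme \<Rightarrow> 'a set \<Rightarrow> nat filter \<Rightarrow> (nat \<Rightarrow> real) \<Rightarrow>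
   ((nat \<Rightarrow> 'a) \<times> (nat \<Rightarrow> 'a)) set" where
  "cone_rel G S \<omega> d =
     {(x, y). x \<in> admissible G S d \<and> y \<in> admissible G S d \<and>
        ((\<lambda>n. word_dist G S (x n) (y n) / d n) \<longlongrightarrow> 0) \<omega>}"

definition cone ::
  "('a, 'b) monoid_scheme \<Rightarrow> 'a set \<Rightarrow> nat filter \<Rightarrow> (nat \<Rightarrow> real) \<Rightarrow> (nat \<Rightarrow> 'a) set set" where
  "cone G S \<omega> d = admissible G S d // cone_rel G S \<omega> d"

definition preserves_admissible ::
  "('a, 'b) monoid_scheme \<Rightarrow> 'a set \<Rightarrow> (nat \<Rightarrow> real) \<Rightarrow> (nat \<Rightarrow> 'a \<Rightarrow> 'a) \<Rightarrow> bool" where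
  "preserves_admissible G S d \<psi> \<longleftrightarrow>
     (\<forall>g\<in>carrier G. \<forall>x\<in>admissible G S d. (\<lambda>n. \<psi> n g \<otimes>\<^bsub>G\<^esub> x n) \<in> admissible G S d)"

text \<open>
  The action \<open>g \<cdot> {x\<^sub>n} = {\<psi>\<^sub>n(g) x\<^sub>n}\<close> on the cone. It is well defined whenever each \<open>\<psi>\<^sub>n\<close> maps the
  group into itself and \<^term>\<open>preserves_admissible G S d \<psi>\<close> holds; left multiplication preserves
  \<^const>\<open>cone_rel\<close>.
\<close>
definition cone_action ::
  "('a, 'b) monoid_scheme \<Rightarrow> 'a set \<Rightarrow> nat filter \<Rightarrow> (nat \<Rightarrow> real) \<Rightarrow> (nat \<Rightarrow> 'a \<Rightarrow> 'a) \<Rightarrow>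
   'a \<Rightarrow> (nat \<Rightarrow> 'a) set \<Rightarrow> (nat \<Rightarrow> 'a) set" where
  "cone_action G S \<omega> d \<psi> g =
     (\<lambda>p\<in>cone G S \<omega> d. \<Union>x\<in>p. cone_rel G S \<omega> d `` {\<lambda>n. \<psi> n g \<otimes>\<^bsub>G\<^esub> x n})"

definition cone_kernel ::
  "('a, 'b) monoid_scheme \<Rightarrow> 'a set \<Rightarrow> nat filter \<Rightarrow> (nat \<Rightarrow> real) \<Rightarrow> (nat \<Rightarrow> 'a \<Rightarrow> 'a) \<Rightarrow> 'a set" where
  "cone_kernel G S \<omega> d \<psi> = kernel G (BijGroup (cone G S \<omega> d)) (cone_action G S \<omega> d \<psi>)"

abbreviation natural_kernel ::
  "('a, 'b) monoid_scheme \<Rightarrow> 'a set \<Rightarrow> nat filter \<Rightarrow> (nat \<Rightarrow> real) \<Rightarrow> 'a set" where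
  "natural_kernel G S \<omega> d \<equiv> cone_kernel G S \<omega> d (\<lambda>n g. g)"

definition paulin_scale :: "('a, 'b) monoid_scheme \<Rightarrow> 'a set \<Rightarrow> ('a \<Rightarrow> 'a) \<Rightarrow> real" where
  "paulin_scale G S \<phi> =
     (INF g\<in>carrier G. Max ((\<lambda>s. word_dist G S g (\<phi> s \<otimes>\<^bsub>G\<^esub> g)) ` S))"

abbreviation paulin_kernel ::
  "('a, 'b) monoid_scheme \<Rightarrow> 'a set \<Rightarrow> nat filter \<Rightarrow> (nat \<Rightarrow> 'a \<Rightarrow> 'a) \<Rightarrow> 'a set" where
  "paulin_kernel G S \<omega> \<phi> \<equiv> cone_kernel G S \<omega> (\<lambda>n. paulin_scale G S (\<phi> n)) \<phi>"

end

theory Submission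
  imports Defs
begin

text \<open>
  Both kernels equal the FC-center of the group, the set of elements with finite conjugacy class.

  Non-elementarity gives a loxodromic element \<open>f\<close> and an element \<open>c\<close> such that, after possibly
  replacing \<open>f\<close> by its inverse, the sequences \<open>f\<^sup>m\<close>, \<open>f\<^sup>-\<^sup>m\<close> and \<open>c f\<^sup>m\<close> move away from the base
  point at linear speed in three different directions. If \<open>k\<close> moves the base point and these three
  points by at most a small multiple of \<open>m\<close>, then it moves the coarse centre of the tripod, and hence
  also a fixed far away point on the axis of \<open>f\<close>, by a uniformly bounded amount. By acylindricity,
  \<open>k\<close> lies in a finite set \<open>F\<close> that does not depend on \<open>m\<close>.

  Let \<open>\<psi>\<^sub>n\<close> be automorphisms and let the scale tend to infinity. Testing an element \<open>g\<close> of the kernel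
  on the three rays shows that \<open>\<psi>\<^sub>n(g)\<close> is in \<open>F\<close> for most \<open>n\<close>. The kernel is normal, so conjugacy
  classes in it have at most \<open>card F\<close> elements. Conversely, the FC-center is contained in \<open>F\<close> and
  invariant under automorphisms, so its elements act trivially on the cone. In Paulin's construction
  the representatives are conjugated so that the infimum defining the scale is attained at the
  identity.
\<close>

section \<open>The four-point condition\<close>

lemma gromov_product_commute:
  assumes "d x y = d y x"
  shows "gromov_product d b x y = gromov_product d b y x"
  using assms by (simp add: gromov_product_def)

context Metric_space
begin

lemma geodesic_segment_dist_add:
  assumes "geodesic_segment M d x y I" and "p \<in> I"
  shows "p \<in> M" and "d x p + d p y = d x y"
proof -
  from assms(1) obtain \<gamma> where \<gamma>: "\<gamma> ` {0..d x y} = I" "I \<subseteq> M" "\<gamma> 0 = x" "\<gamma> (d x y) = y"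
    and iso: "\<And>s t. s \<in> {0..d x y} \<Longrightarrow> t \<in> {0..d x y} \<Longrightarrow> d (\<gamma> s) (\<gamma> t) = \<bar>s - t\<bar>"
    unfolding geodesic_segment_def by blast
  obtain t where t: "t \<in> {0..d x y}" "p = \<gamma> t" using \<gamma>(1) assms(2) by blast
  show "p \<in> M" using \<gamma>(2) assms(2) by blast
  have "d x p = t" using iso[of 0 t] t \<gamma>(3) by simp
  moreover have "d p y = d x y - t" using iso[of t "d x y"] t \<gamma>(4) by simp
  ultimately show "d x p + d p y = d x y" by simp
qed

lemma geodesic_segment_ends:
  assumes "geodesic_segment M d x y I"
  shows "x \<in> I" "y \<in> I"
proof -
  from assms obtain \<gamma> where "\<gamma> ` {0..d x y} = I" "\<gamma> 0 = x" "\<gamma> (d x y) = y"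
    unfolding geodesic_segment_def by blast
  then show "x \<in> I" "y \<in> I"
    using image_eqI[of x \<gamma> 0 "{0..d x y}"] image_eqI[of y \<gamma> "d x y" "{0..d x y}"] by auto
qed

text \<open>Together with \<open>dist_segment_le_gromov_product\<close> this makes the Gromov
  product a coarse distance from the base point to a geodesic, which is how thin triangles yield the
  four-point condition.\<close>

lemma gromov_product_le_dist_segment:
  assumes "geodesic_segment M d x y I" "p \<in> I" "x \<in> M" "y \<in> M" "b \<in> M"
  shows "gromov_product d b x y \<le> d b p"
  using geodesic_segment_dist_add[OF assms(1,2)] triangle[of x p b] triangle[of y p b] assms
    commute[of p b] commute[of p y]
  by (simp add: gromov_product_def)

text \<open>Along the segment, take a parameter near the supremum of those whose point is close to
  \<open>K\<close>; a point at most 1 further on is close to \<open>J\<close>. The extra 1 avoids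
  asking whether the supremum is attained.\<close>

lemma segment_point_near_both_sides:
  assumes thin: "\<And>p. p \<in> I \<Longrightarrow> \<exists>q\<in>J \<union> K. d p q \<le> \<delta>"
    and I: "geodesic_segment M d x y I" and J: "geodesic_segment M d y b J"
    and K: "geodesic_segment M d b x K"
    and M: "x \<in> M" "y \<in> M" "b \<in> M" and "0 \<le> \<delta>"
  obtains p q r where "p \<in> I" "q \<in> J" "r \<in> K" "d p q \<le> \<delta> + 1" "d p r \<le> \<delta> + 1"
proof -
  let ?l = "d x y"
  from I obtain \<gamma> where \<gamma>: "\<gamma> ` {0..?l} = I" "I \<subseteq> M" "\<gamma> 0 = x" "\<gamma> ?l = y"
    and iso: "\<And>s t. s \<in> {0..?l} \<Longrightarrow> t \<in> {0..?l} \<Longrightarrow> d (\<gamma> s) (\<gamma> t) = \<bar>s - t\<bar>"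
    unfolding geodesic_segment_def by blast
  have xK: "x \<in> K" and yJ: "y \<in> J"
    using geodesic_segment_ends[OF J] geodesic_segment_ends[OF K] by auto
  define V where "V = {t \<in> {0..?l}. \<exists>r\<in>K. d (\<gamma> t) r \<le> \<delta>}"
  have V0: "0 \<in> V" using xK M \<open>0 \<le> \<delta>\<close> \<gamma>(3) unfolding V_def by force
  have bdd: "bdd_above V" unfolding V_def by (intro bdd_aboveI[of _ ?l]) auto
  obtain t where t: "t \<in> V" "Sup V - 1 < t"
    using less_cSupD[of V "Sup V - 1"] V0 by auto
  have tl: "t \<in> {0..?l}" using t by (simp add: V_def)
  obtain r where r: "r \<in> K" "d (\<gamma> t) r \<le> \<delta>" using t(1) unfolding V_def by blast
  \<comment> \<open>\<open>t + 1\<close> lies beyond \<open>Sup V\<close>, so the point at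
    \<open>t'\<close> is not close to \<open>K\<close> unless \<open>t'\<close> is cut off at the
    end \<open>y\<close>, which lies on \<open>J\<close>.\<close>
  define t' where "t' = min (t + 1) ?l"
  have t': "t' \<in> {0..?l}" "\<bar>t - t'\<bar> \<le> 1" using tl by (auto simp: t'_def)
  have inM: "\<gamma> t \<in> M" "\<gamma> t' \<in> M" using \<gamma>(1,2) tl t' by blast+
  have "\<exists>q\<in>J. d (\<gamma> t') q \<le> \<delta>"
  proof (cases "t + 1 \<le> ?l")
    case True
    then have "t' \<notin> V" using t(2) cSup_upper[OF _ bdd, of t'] by (auto simp: t'_def)
    then show ?thesis using thin[of "\<gamma> t'"] \<gamma>(1) t' unfolding V_def by blast
  next
    case False
    then show ?thesis using yJ \<gamma>(4) M \<open>0 \<le> \<delta>\<close> by (intro bexI[of _ y]) (auto simp: t'_def)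
  qed
  then obtain q where q: "q \<in> J" "d (\<gamma> t') q \<le> \<delta>" by blast
  have "q \<in> M" using geodesic_segment_dist_add(1)[OF J q(1)] .
  then have "d (\<gamma> t) q \<le> \<delta> + 1"
    using triangle[of "\<gamma> t" "\<gamma> t'" q] inM iso[OF tl t'(1)] t'(2) q(2) by simp
  moreover have "\<gamma> t \<in> I" using \<gamma>(1) tl by blast
  ultimately show thesis using that[of "\<gamma> t" q r] q(1) r by simp
qed

lemma hyperbolic_spaceD:
  assumes "hyperbolic_space M d \<delta>"
  shows "\<lbrakk>x \<in> M; y \<in> M\<rbrakk> \<Longrightarrow> \<exists>I. geodesic_segment M d x y I"
    and "\<lbrakk>x \<in> M; y \<in> M; z \<in> M; geodesic_segment M d x y I; geodesic_segment M d y z J;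
      geodesic_segment M d z x K; p \<in> I\<rbrakk> \<Longrightarrow> \<exists>q\<in>J \<union> K. d p q \<le> \<delta>"
  using assms unfolding hyperbolic_space_def by simp_all

text \<open>Take the point \<open>p\<close> close to both sides through \<open>b\<close>. Detours
  through \<open>r\<close> and \<open>q\<close> show that \<open>d b p + d p x\<close> and
  \<open>d b p + d p y\<close> exceed \<open>d b x\<close> and \<open>d b y\<close> by at most
  \<open>2 * (\<delta> + 1)\<close>; averaging gives the bound.\<close>

lemma dist_segment_le_gromov_product:
  assumes hyp: "hyperbolic_space M d \<delta>" and "0 \<le> \<delta>" and I: "geodesic_segment M d x y I"
    and M: "x \<in> M" "y \<in> M" "b \<in> M"
  obtains p where "p \<in> I" "d b p \<le> gromov_product d b x y + 2 * (\<delta> + 1)"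
proof -
  obtain J K where J: "geodesic_segment M d y b J" and K: "geodesic_segment M d b x K"
    using hyperbolic_spaceD(1)[OF hyp] M by metis
  note thin = hyperbolic_spaceD(2)[OF hyp M I J K]
  obtain p q r where pqr: "p \<in> I" "q \<in> J" "r \<in> K" "d p q \<le> \<delta> + 1" "d p r \<le> \<delta> + 1"
    using segment_point_near_both_sides[OF thin I J K M \<open>0 \<le> \<delta>\<close>] by blast
  note p = geodesic_segment_dist_add[OF I pqr(1)]
    and q = geodesic_segment_dist_add[OF J pqr(2)] and r = geodesic_segment_dist_add[OF K pqr(3)]
  have "d b p \<le> d b r + d r p" "d p x \<le> d p r + d r x" "d b p \<le> d b q + d q p" "d y p \<le> d y q + d q p"
    using p q r M by (auto intro!: triangle)
  then have "d b p \<le> gromov_product d b x y + 2 * (\<delta> + 1)"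
    unfolding gromov_product_def using p(2) q(2) r(2) pqr(4,5) commute[of p q] commute[of p r]
      commute[of b q] commute[of x p] commute[of y p] commute[of b x] by argo
  with pqr(1) that show thesis by blast
qed

text \<open>Pick \<open>p\<close> on the side from \<open>x\<close> to \<open>z\<close> with
  \<open>d b p\<close> at most the Gromov product plus \<open>2 * (\<delta> + 1)\<close>. By
  thinness some \<open>q\<close> on another side is within \<open>\<delta>\<close> of
  \<open>p\<close>, and \<open>d b q\<close> is an upper bound for the Gromov product belonging to
  that side.\<close>

lemma four_point_condition:
  assumes hyp: "hyperbolic_space M d \<delta>" and "0 \<le> \<delta>" and M: "x \<in> M" "y \<in> M" "z \<in> M" "b \<in> M"
  shows "min (gromov_product d b x y) (gromov_product d b y z) - (3 * \<delta> + 2)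
         \<le> gromov_product d b x z"
proof -
  obtain I J K where seg: "geodesic_segment M d x z I" "geodesic_segment M d z y J"
      "geodesic_segment M d y x K"
    using hyperbolic_spaceD(1)[OF hyp] M by metis
  obtain p where p: "p \<in> I" "d b p \<le> gromov_product d b x z + 2 * (\<delta> + 1)"
    using dist_segment_le_gromov_product[OF hyp \<open>0 \<le> \<delta>\<close> seg(1)] M by blast
  obtain q where q: "q \<in> J \<union> K" "d p q \<le> \<delta>"
    using hyperbolic_spaceD(2)[OF hyp M(1,3,2) seg p(1)] by blast
  have "gromov_product d b z y \<le> d b q \<or> gromov_product d b y x \<le> d b q"
    using q(1) gromov_product_le_dist_segment[OF seg(2)] gromov_product_le_dist_segment[OF seg(3)] M
    by blast
  then have "min (gromov_product d b x y) (gromov_product d b y z) \<le> d b q"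
    using gromov_product_commute[of d x y b] gromov_product_commute[of d y z b] commute by auto
  moreover have "d b q \<le> d b p + d p q"
    using geodesic_segment_dist_add(1) seg p(1) q(1) M by (blast intro: triangle)
  ultimately have "min (gromov_product d b x y) (gromov_product d b y z) \<le>
      gromov_product d b x z + (3 * \<delta> + 2)"
    using p(2) q(2) by argo
  then show ?thesis by (simp only: diff_le_eq)
qed

end

section \<open>Left-invariant hyperbolic pseudometrics\<close>

text \<open>Abstracts the distance \<open>d (\<alpha> x p) (\<alpha> y p)\<close> between orbit
  points, only a pseudometric because \<open>p\<close> may have a nontrivial stabilizer. Here
  \<open>\<delta>\<close> is the constant of the four-point condition, not that of thin
  triangles.\<close>

locale hyperbolic_pseudometric = group G for G (structure) +
  fixes D :: "'a \<Rightarrow> 'a \<Rightarrow> real" and \<delta> :: real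
  assumes D_self: "x \<in> carrier G \<Longrightarrow> D x x = 0"
    and D_commute: "D x y = D y x"
    and D_triangle: "\<lbrakk>x \<in> carrier G; y \<in> carrier G; z \<in> carrier G\<rbrakk> \<Longrightarrow> D x z \<le> D x y + D y z"
    and D_left: "\<lbrakk>g \<in> carrier G; x \<in> carrier G; y \<in> carrier G\<rbrakk> \<Longrightarrow> D (g \<otimes> x) (g \<otimes> y) = D x y"
    and delta_pos: "0 < \<delta>"
    and four_point: "\<lbrakk>b \<in> carrier G; x \<in> carrier G; y \<in> carrier G; z \<in> carrier G\<rbrakk> \<Longrightarrow>
      min (gromov_product D b x y) (gromov_product D b y z) - \<delta> \<le> gromov_product D b x z"
begin

abbreviation gp :: "'a \<Rightarrow> 'a \<Rightarrow> 'a \<Rightarrow> real" where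
  "gp \<equiv> gromov_product D"

lemma gp_commute: "gp b x y = gp b y x"
  by (rule gromov_product_commute) (rule D_commute)

text \<open>The two products are the pieces into which the comparison tripod divides the side from
  \<open>b\<close> to \<open>x\<close>. This trades a small product seen from \<open>x\<close> for a
  large one seen from \<open>b\<close>.\<close>

lemma gp_add: "gp b x y + gp x b y = D b x"
  unfolding gromov_product_def using D_commute[of b x] D_commute[of x y] D_commute[of b y]
  by argo

lemma gp_left:
  "\<lbrakk>g \<in> carrier G; b \<in> carrier G; x \<in> carrier G; y \<in> carrier G\<rbrakk> \<Longrightarrow>
    gp (g \<otimes> b) (g \<otimes> x) (g \<otimes> y) = gp b x y"
  by (simp add: gromov_product_def D_left)

lemma gp_nonneg: "\<lbrakk>b \<in> carrier G; x \<in> carrier G; y \<in> carrier G\<rbrakk> \<Longrightarrow> 0 \<le> gp b x y"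
  using D_triangle[of x b y] D_commute[of b y] by (simp add: gromov_product_def)

lemma D_nonneg: "\<lbrakk>x \<in> carrier G; y \<in> carrier G\<rbrakk> \<Longrightarrow> 0 \<le> D x y"
  using D_triangle[of x y x] D_self[of x] D_commute[of x y] by simp

lemma D_one_inv: "x \<in> carrier G \<Longrightarrow> D \<one> (inv x) = D \<one> x"
  using D_left[of x \<one> "inv x"] D_commute[of x \<one>] by simp

lemma D_conj: "\<lbrakk>x \<in> carrier G; k \<in> carrier G\<rbrakk> \<Longrightarrow> D x (k \<otimes> x) = D \<one> (inv x \<otimes> k \<otimes> x)"
  using D_left[of x \<one> "inv x \<otimes> k \<otimes> x"] by (simp flip: m_assoc)

lemma gp_translate:
  "\<lbrakk>x \<in> carrier G; y \<in> carrier G; z \<in> carrier G\<rbrakk> \<Longrightarrow> gp x y z = gp \<one> (inv x \<otimes> y) (inv x \<otimes> z)"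
  using gp_left[of "inv x" x y z] by simp

section \<open>Coarse axes of loxodromic elements\<close>

definition quasi_axis :: "'a \<Rightarrow> real \<Rightarrow> real \<Rightarrow> bool" where
  "quasi_axis f E \<tau> \<longleftrightarrow> f \<in> carrier G \<and> 0 < \<tau> \<and>
     (\<forall>(m::nat) (n::nat). gp \<one> (inv (f [^] m)) (f [^] n) \<le> E) \<and> (\<forall>n::nat. \<tau> * real n \<le> D \<one> (f [^] n))"

lemma quasi_axis_inv: "quasi_axis f E \<tau> \<Longrightarrow> quasi_axis (inv f) E \<tau>"
  unfolding quasi_axis_def by (auto simp: nat_pow_inv D_one_inv gp_commute[of \<one> "f [^] _"])

lemma quasi_axisD:
  assumes "quasi_axis f E \<tau>"
  shows "f \<in> carrier G" "0 < \<tau>" "gp \<one> (inv (f [^] (m::nat))) (f [^] (n::nat)) \<le> E"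
    "\<tau> * real n \<le> D \<one> (f [^] n)"
  using assms unfolding quasi_axis_def by auto

lemma inv_pow_mult_pow:
  assumes "f \<in> carrier G" "(m::nat) \<le> n"
  shows "inv (f [^] m) \<otimes> f [^] n = f [^] (n - m)"
proof -
  have "f [^] n = f [^] m \<otimes> f [^] (n - m)" using assms by (simp add: nat_pow_mult)
  then show ?thesis using assms by (simp flip: m_assoc)
qed

text \<open>Translation by \<open>inv (f [^] j)\<close> turns the three points into
  \<open>\<one>\<close>, \<open>inv (f [^] j)\<close> and \<open>f [^] (m - j)\<close>, and the last
  two diverge at \<open>\<one>\<close>.\<close>

lemma quasi_axis_between:
  assumes "quasi_axis f E \<tau>" "j \<le> m"
  shows "gp (f [^] j) \<one> (f [^] (m::nat)) \<le> E"
  using quasi_axisD(1)[OF assms(1)] quasi_axisD(3)[OF assms(1), of j "m - j"] assms(2)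
  by (simp add: gp_translate[of "f [^] j"] inv_pow_mult_pow)

text \<open>By \<open>quasi_axis_between\<close> the lower power lies coarsely between
  \<open>\<one>\<close> and the higher one, so the way to the higher power runs past the lower
  one.\<close>

lemma quasi_axis_same_direction:
  assumes "quasi_axis f E \<tau>"
  shows "min (D \<one> (f [^] (m::nat))) (D \<one> (f [^] (n::nat))) - E \<le> gp \<one> (f [^] m) (f [^] n)"
proof (cases "m \<le> n")
  case True
  then show ?thesis
    using gp_add[of \<one> "f [^] m" "f [^] n"] quasi_axis_between[OF assms True] by linarith
next
  case False
  then have "gp (f [^] n) \<one> (f [^] m) \<le> E" using quasi_axis_between[OF assms] by simp
  then show ?thesis
    using gp_add[of \<one> "f [^] n" "f [^] m"] gp_commute[of \<one> "f [^] n" "f [^] m"] by linarith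
qed

text \<open>Local-to-global principle for the broken path through the powers of \<open>f\<close>.
  Seen from \<open>f [^] Suc n\<close>, the starting point lies in the direction of the previous
  vertex, by the induction hypothesis and because the step is long, while the next vertex diverges
  from the previous one. The four-point condition then makes the next vertex diverge from the
  starting point, and the length of the step keeps the error from accumulating.\<close>

lemma local_turn:
  assumes f: "f \<in> carrier G" and \<kappa>: "gp \<one> (inv f) f \<le> \<kappa>" "2 * \<kappa> + 3 * \<delta> < D \<one> f"
  shows "gp (f [^] n) \<one> (f [^] Suc n) \<le> \<kappa> + \<delta>"
proof (induction n)
  case 0
  have "0 \<le> \<kappa>" using \<kappa>(1) gp_nonneg[of \<one> "inv f" f] f by simp
  then show ?case using f delta_pos by (simp add: gromov_product_def D_self D_commute[of \<one> f])
next
  case (Suc n)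
  let ?p = "\<lambda>i::nat. f [^] i"
  have "D (?p n) (?p (Suc n)) = D \<one> f"
    using D_left[of "?p n" \<one> f] f by simp
  then have 1: "D \<one> f - \<kappa> - \<delta> \<le> gp (?p (Suc n)) (?p n) \<one>"
    using Suc gp_add[of "?p n" "?p (Suc n)" \<one>] gp_commute[of "?p n" "?p (Suc n)" \<one>] by linarith
  have "?p (Suc n) \<otimes> inv f = ?p n" using f by (simp add: m_assoc)
  then have "gp (?p (Suc n)) (?p n) (?p (Suc (Suc n))) \<le> \<kappa>"
    using gp_left[of "?p (Suc n)" \<one> "inv f" f] f \<kappa>(1) by simp
  then show ?case
    using four_point[of "?p (Suc n)" "?p n" \<one> "?p (Suc (Suc n))"] 1 f \<kappa>(2) delta_pos
    by (auto simp: min_def split: if_splits)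
qed

text \<open>The turn at the first vertex is a turn at the last vertex of the reversed path: apply
  \<open>local_turn\<close> to \<open>inv f\<close> and translate by
  \<open>f [^] Suc n\<close>.\<close>

lemma local_turn':
  assumes f: "f \<in> carrier G" and \<kappa>: "gp \<one> (inv f) f \<le> \<kappa>" "2 * \<kappa> + 3 * \<delta> < D \<one> f"
  shows "gp f \<one> (f [^] Suc n) \<le> \<kappa> + \<delta>"
proof -
  have "gp (inv f [^] n) \<one> (inv f [^] Suc n) \<le> \<kappa> + \<delta>"
    using f \<kappa> by (intro local_turn) (auto simp: D_one_inv gp_commute[of \<one> f])
  moreover have "f [^] Suc n \<otimes> inv f [^] n = f"
  proof -
    have "f [^] Suc n = f \<otimes> f [^] n" by (rule nat_pow_Suc2[OF f])
    then show ?thesis using f by (simp add: nat_pow_inv m_assoc)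
  qed
  moreover have "f [^] Suc n \<otimes> inv f [^] Suc n = \<one>"
    using f nat_pow_inv[of f "Suc n"] by (metis nat_pow_closed r_inv)
  ultimately show ?thesis
    using gp_left[of "f [^] Suc n" "inv f [^] n" \<one> "inv f [^] Suc n"] f gp_commute[of f \<one>]
    by (simp del: nat_pow_Suc)
qed

text \<open>Bounded backtracking at each vertex makes the distance from \<open>\<one>\<close> grow
  by a fixed amount per step. For the divergence of opposite powers, \<open>f [^] n\<close> sets out
  in the direction of \<open>f\<close> by \<open>local_turn'\<close>, and
  \<open>inv (f [^] m)\<close> diverges from \<open>f\<close> by \<open>local_turn\<close> at
  \<open>f [^] m\<close>.\<close>

lemma quasi_axis_if_local:
  assumes f: "f \<in> carrier G" and \<kappa>: "gp \<one> (inv f) f \<le> \<kappa>" "2 * \<kappa> + 3 * \<delta> < D \<one> f"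
  shows "quasi_axis f (\<kappa> + 2 * \<delta>) (D \<one> f - 2 * \<kappa> - 2 * \<delta>)"
proof -
  let ?p = "\<lambda>i::nat. f [^] i" and ?\<tau> = "D \<one> f - 2 * \<kappa> - 2 * \<delta>"
  note turn = local_turn[OF f \<kappa>]
  have step: "D (?p n) (?p (Suc n)) = D \<one> f" for n using D_left[of "?p n" \<one> f] f by simp
  have \<kappa>0: "0 \<le> \<kappa>" using \<kappa>(1) gp_nonneg[of \<one> "inv f" f] f by simp
  have "?\<tau> * real n \<le> D \<one> (?p n)" for n
  proof (induction n)
    case (Suc n)
    have "2 * gp (?p n) \<one> (?p (Suc n)) = D \<one> (?p n) + D \<one> f - D \<one> (?p (Suc n))"
      using step[of n] D_commute[of "?p (Suc n)" "?p n"] by (simp add: gromov_product_def)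
    then show ?case using Suc turn[of n] by (simp add: algebra_simps)
  qed (simp add: D_self)
  moreover have "gp \<one> (inv (?p m)) (?p n) \<le> \<kappa> + 2 * \<delta>" for m n
  proof (cases n)
    case 0
    then show ?thesis using f \<kappa>0 delta_pos by (simp add: gromov_product_def D_self D_commute[of "inv _" \<one>])
  next
    case (Suc n')
    have 1: "gp \<one> (inv (?p m)) f \<le> \<kappa> + \<delta>"
      using turn[of m] gp_translate[of "?p m" \<one> "?p (Suc m)"] f inv_pow_mult_pow[OF f, of m "Suc m"]
      by (simp del: nat_pow_Suc)
    have 2: "D \<one> f - \<kappa> - \<delta> \<le> gp \<one> (?p n) f"
      using gp_add[of \<one> f "?p n"] local_turn'[OF f \<kappa>, of n'] gp_commute[of \<one> f "?p n"] Suc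
      by (simp del: nat_pow_Suc)
    show ?thesis using four_point[of \<one> "inv (?p m)" "?p n" f] 1 2 f \<kappa>(2) delta_pos by simp
  qed
  ultimately show ?thesis using f \<kappa>(2) delta_pos by (simp add: quasi_axis_def)
qed

text \<open>
  If neither \<open>g\<close> nor \<open>h\<close> is loxodromic, then \<open>g\<close> and \<open>inv g\<close> point in the same direction, and so do
  \<open>h\<close> and \<open>inv h\<close>. Hence \<open>inv g \<otimes> h\<close> points in the direction of \<open>g\<close> and its inverse in that of \<open>h\<close>.
\<close>
lemma ex_quasi_axis:
  assumes gh: "g \<in> carrier G" "h \<in> carrier G" and C: "gp \<one> g h \<le> C"
    and g: "4 * C + 20 * \<delta> < D \<one> g" and h: "4 * C + 20 * \<delta> < D \<one> h"
  shows "\<exists>f E \<tau>. quasi_axis f E \<tau>"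
proof (cases "2 * gp \<one> (inv g) g + 3 * \<delta> < D \<one> g \<or> 2 * gp \<one> (inv h) h + 3 * \<delta> < D \<one> h")
  case True
  then show ?thesis using quasi_axis_if_local[OF gh(1) order_refl] quasi_axis_if_local[OF gh(2) order_refl]
    by blast
next
  case False
  then have notg: "D \<one> g \<le> 2 * gp \<one> (inv g) g + 3 * \<delta>"
    and noth: "D \<one> h \<le> 2 * gp \<one> (inv h) h + 3 * \<delta>" by auto
  let ?f = "inv g \<otimes> h"
  have C0: "0 \<le> C" using gp_nonneg[of \<one> g h] C gh by simp
  have f: "?f \<in> carrier G" "inv ?f = inv h \<otimes> g" using gh by (auto simp: inv_mult_group)
  have Df: "D \<one> ?f = D g h" using D_left[of "inv g" g h] gh by simp
  have "D \<one> g + D \<one> h - 2 * C \<le> D \<one> ?f"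
    using C unfolding Df gromov_product_def using D_commute[of g \<one>] D_commute[of h \<one>] by argo
  moreover have 1: "gp \<one> (inv g) ?f = D \<one> g - gp \<one> g h"
    using gp_translate[of g \<one> h] gp_add[of \<one> g h] gh by simp
  have 2: "gp \<one> (inv h) (inv ?f) = D \<one> h - gp \<one> g h"
    using gp_translate[of h \<one> g] gp_add[of \<one> h g] gh f by (simp add: gp_commute[of \<one> h g])
  have "gp \<one> (inv ?f) ?f \<le> C + 5 * \<delta>"
  proof (rule ccontr)
    assume "\<not> ?thesis"
    then have 3: "C + 5 * \<delta> < gp \<one> ?f (inv ?f)" by (simp add: gp_commute)
    \<comment> \<open>The directions \<open>g\<close>, \<open>inv g\<close>, \<open>?f\<close>,
      \<open>inv ?f\<close>, \<open>inv h\<close>, \<open>h\<close> are identified one after the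
      other, each use of the four-point condition costing \<open>\<delta>\<close>, until the product
      of \<open>g\<close> and \<open>h\<close> exceeds \<open>C\<close>.\<close>
    have "C + 4 * \<delta> < gp \<one> g ?f"
      using four_point[of \<one> g "inv g" ?f] notg g 1 C gh C0 f delta_pos gp_commute[of \<one> g "inv g"]
      by simp
    then have "C + 3 * \<delta> < gp \<one> g (inv ?f)"
      using four_point[of \<one> g ?f "inv ?f"] 3 gh f(1) delta_pos by (simp del: f(2))
    then have "C + 2 * \<delta> < gp \<one> g (inv h)"
      using four_point[of \<one> g "inv ?f" "inv h"] 2 h C C0 gh f(1) delta_pos gp_commute[of \<one> "inv h" "inv ?f"]
      by (simp del: f(2))
    then have "C + \<delta> < gp \<one> g h"
      using four_point[of \<one> g "inv h" h] noth h C0 gh delta_pos by simp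
    then show False using C delta_pos by simp
  qed
  moreover have "0 < D \<one> g" "0 < D \<one> h" using g h C0 delta_pos by simp_all
  ultimately have "quasi_axis ?f (C + 5 * \<delta> + 2 * \<delta>) (D \<one> ?f - 2 * (C + 5 * \<delta>) - 2 * \<delta>)"
    using g h C0 f(1) delta_pos by (intro quasi_axis_if_local) auto
  then show ?thesis by blast
qed

text \<open>Coarse uniqueness of the centre of a tripod: both \<open>\<one>\<close> and \<open>k\<close> are centres of \<open>a, b, c\<close>.\<close>
lemma tripod_centre_displacement:
  assumes G: "k \<in> carrier G" "a \<in> carrier G" "b \<in> carrier G" "c \<in> carrier G"
    and E: "gp \<one> a b \<le> E" "gp \<one> a c \<le> E" "gp \<one> b c \<le> E"
    and e: "D \<one> k \<le> e" "D a (k \<otimes> a) \<le> e" "D b (k \<otimes> b) \<le> e" "D c (k \<otimes> c) \<le> e"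
    and far: "e + E + 2 * \<delta> < D \<one> a" "e + E + 2 * \<delta> < D \<one> b" "e + E + 2 * \<delta> < D \<one> c"
  shows "D \<one> k \<le> 2 * E + 4 * \<delta>"
proof -
  \<comment> \<open>\<open>x\<close> is moved little compared with its distance, so \<open>x\<close>
    and \<open>k \<otimes> x\<close> lie in the same direction from \<open>k\<close>.\<close>
  have near: "E + 2 * \<delta> < gp k x (k \<otimes> x)"
    if x: "x \<in> carrier G" "D x (k \<otimes> x) \<le> e" "e + E + 2 * \<delta> < D \<one> x" for x
    using D_left[of k x \<one>] D_triangle[of x k \<one>] D_commute[of x \<one>] D_commute[of k \<one>] x e(1) G(1)
    unfolding gromov_product_def by simp
  \<comment> \<open>\<open>k\<close> is a centre of the translated tripod, and \<open>near\<close>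
    replaces the translated endpoints by the original ones.\<close>
  have centre: "gp k x y \<le> E + 2 * \<delta>"
    if x: "x \<in> carrier G" "D x (k \<otimes> x) \<le> e" "e + E + 2 * \<delta> < D \<one> x"
      and y: "y \<in> carrier G" "D y (k \<otimes> y) \<le> e" "e + E + 2 * \<delta> < D \<one> y" and xy: "gp \<one> x y \<le> E"
    for x y
    using gp_left[of k \<one> x y] xy near[OF x] near[OF y] x(1) y(1) G(1)
      four_point[of k "k \<otimes> x" x "k \<otimes> y"] four_point[of k x y "k \<otimes> y"]
      gp_commute[of k x "k \<otimes> x"] delta_pos by (auto simp: min_def split: if_splits)
  have one: "gp \<one> x k \<le> E + \<delta> \<or> gp \<one> y k \<le> E + \<delta>"
    if "x \<in> carrier G" "y \<in> carrier G" "gp \<one> x y \<le> E" for x y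
    using four_point[of \<one> x k y] gp_commute[of \<one> k y] that G(1) by (auto simp: min_def split: if_splits)
  have two: "gp k x \<one> \<le> E + 3 * \<delta> \<or> gp k y \<one> \<le> E + 3 * \<delta>"
    if "x \<in> carrier G" "y \<in> carrier G" "gp k x y \<le> E + 2 * \<delta>" for x y
    using four_point[of k x \<one> y] gp_commute[of k \<one> y] that G(1) by (auto simp: min_def split: if_splits)
  have ab: "gp k a b \<le> E + 2 * \<delta>" using centre[OF G(2) e(2) far(1) G(3) e(3) far(2) E(1)] .
  have ac: "gp k a c \<le> E + 2 * \<delta>" using centre[OF G(2) e(2) far(1) G(4) e(4) far(3) E(2)] .
  have bc: "gp k b c \<le> E + 2 * \<delta>" using centre[OF G(3) e(3) far(2) G(4) e(4) far(3) E(3)] .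
  \<comment> \<open>Of any two branches one satisfies the bound at \<open>\<one>\<close>, so at most
    one of the three fails there, and likewise at \<open>k\<close>. Hence some branch satisfies both
    bounds, and their sum bounds \<open>D \<one> k\<close>.\<close>
  obtain x where "gp \<one> x k \<le> E + \<delta>" "gp k x \<one> \<le> E + 3 * \<delta>"
    using one[OF G(2,3) E(1)] one[OF G(2,4) E(2)] one[OF G(3,4) E(3)]
      two[OF G(2,3) ab] two[OF G(2,4) ac] two[OF G(3,4) bc] by blast
  then show ?thesis using gp_add[of \<one> k x] gp_commute[of \<one> k x] gp_commute[of k \<one> x] by simp
qed

text \<open>\<open>y\<close> lies coarsely between \<open>\<one>\<close> and \<open>a\<close>, and
  \<open>k \<otimes> y\<close> between \<open>k\<close> and \<open>k \<otimes> a\<close>. As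
  \<open>a\<close> is far away and moved little, both paths share a direction up to the distance of
  \<open>y\<close>. So \<open>y\<close> and \<open>k \<otimes> y\<close> lie at nearly the same
  distance in the same direction from \<open>\<one>\<close>.\<close>

lemma displacement_along:
  assumes G: "k \<in> carrier G" "a \<in> carrier G" "y \<in> carrier G"
    and y: "gp y \<one> a \<le> E" and k: "D \<one> k \<le> \<Delta>" and e: "D a (k \<otimes> a) \<le> e"
    and far: "D \<one> y + e + \<Delta> \<le> D \<one> a" and "0 \<le> E" "0 \<le> \<Delta>"
  shows "D y (k \<otimes> y) \<le> 2 * E + 5 * \<Delta> + 4 * \<delta>"
proof -
  let ?y = "k \<otimes> y" and ?a = "k \<otimes> a"
  have Dy: "D k ?y = D \<one> y" "D k ?a = D \<one> a" using D_left[of k \<one>] G by auto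
  have tri: "D \<one> ?y \<le> \<Delta> + D \<one> y" "D \<one> y \<le> D \<one> ?y + \<Delta>" "D \<one> ?a \<le> \<Delta> + D \<one> a" "D \<one> a \<le> D \<one> ?a + \<Delta>"
    using D_triangle[of \<one> k ?y] D_triangle[of k \<one> ?y] D_triangle[of \<one> k ?a] D_triangle[of k \<one> ?a]
      D_commute[of k \<one>] k G Dy by auto
  have gp: "2 * gp \<one> x z = D \<one> x + D \<one> z - D x z" for x z
    by (simp add: gromov_product_def D_commute[of _ \<one>])
  have 1: "D \<one> y - E \<le> gp \<one> y a" using gp_add[of \<one> y a] y by simp
  have "D y a = D ?y ?a" using D_left[of k y a] G by simp
  then have 2: "D \<one> y - E - \<Delta> \<le> gp \<one> ?y ?a"
    using 1 gp[of y a] gp[of ?y ?a] tri by simp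
  have 3: "D \<one> y \<le> gp \<one> a ?a"
    using far tri e gp[of a ?a] \<open>0 \<le> \<Delta>\<close> D_nonneg[of a ?a] G by simp
  have "D \<one> y - E - \<Delta> - \<delta> \<le> gp \<one> a ?y"
    using four_point[of \<one> a ?a ?y] 2 3 G gp_commute[of \<one> ?a ?y] \<open>0 \<le> E\<close> \<open>0 \<le> \<Delta>\<close>
    by (auto simp: min_def split: if_splits)
  then have "D \<one> y - E - \<Delta> - 2 * \<delta> \<le> gp \<one> y ?y"
    using four_point[of \<one> y a ?y] 1 G delta_pos \<open>0 \<le> \<Delta>\<close> by (auto simp: min_def split: if_splits)
  then show ?thesis using tri gp[of y ?y] \<open>0 \<le> \<Delta>\<close> by simp
qed

section \<open>Three rays in different directions\<close>

lemma gp_le_D: "\<lbrakk>b \<in> carrier G; x \<in> carrier G; y \<in> carrier G\<rbrakk> \<Longrightarrow> gp b x y \<le> D b x"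
  using gp_add[of b x y] gp_nonneg[of x b y] by simp

text \<open>All powers of \<open>f\<close> point in one direction, so two elements that both follow
  it for long would follow each other for longer than \<open>C\<close>.\<close>

lemma quasi_axis_separates:
  assumes ax: "quasi_axis f E \<tau>" and x: "x \<in> carrier G" and y: "y \<in> carrier G"
    and "0 \<le> E" and C: "gp \<one> x y \<le> C"
    and Q: "C + E + 2 * \<delta> < gp \<one> x (f [^] (m::nat))" "C + E + 2 * \<delta> < gp \<one> y (f [^] (n::nat))"
  shows False
proof -
  note f = quasi_axisD(1)[OF ax]
  have "C + 2 * \<delta> < gp \<one> (f [^] m) (f [^] n)"
    using quasi_axis_same_direction[OF ax, of m n] gp_le_D[of \<one> "f [^] m" x]
      gp_le_D[of \<one> "f [^] n" y] gp_commute[of \<one> "f [^] m" x] gp_commute[of \<one> "f [^] n" y] Q f x y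
    by (auto simp: min_def split: if_splits)
  then have "C + \<delta> < gp \<one> x (f [^] n)"
    using four_point[of \<one> x "f [^] m" "f [^] n"] Q \<open>0 \<le> E\<close> f x
    by (auto simp: min_def split: if_splits)
  then show False
    using four_point[of \<one> x "f [^] n" y] Q gp_commute[of \<one> y "f [^] n"] C \<open>0 \<le> E\<close> delta_pos f x y
    by (auto simp: min_def split: if_splits)
qed

text \<open>The path to \<open>x \<otimes> y\<close> passes near \<open>x\<close> because
  \<open>inv x\<close> and \<open>y\<close> diverge. Since \<open>z\<close> has already parted from
  \<open>x\<close> by then, it parts from \<open>x \<otimes> y\<close> at the same place.\<close>

lemma translated_ray:
  assumes G: "x \<in> carrier G" "y \<in> carrier G" "z \<in> carrier G"
    and y: "gp \<one> (inv x) y \<le> E" and z: "gp \<one> x z \<le> Q" and far: "Q + E + \<delta> < D \<one> x"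
  shows "gp \<one> z (x \<otimes> y) \<le> Q + \<delta>"
proof -
  have "gp x \<one> (x \<otimes> y) \<le> E" using gp_left[of x \<one> "inv x" y] y G by simp
  then have "Q + \<delta> < gp \<one> x (x \<otimes> y)" using gp_add[of \<one> x "x \<otimes> y"] far by linarith
  then show ?thesis
    using four_point[of \<one> x "x \<otimes> y" z] z G gp_commute[of \<one> z "x \<otimes> y"]
    by (auto simp: min_def split: if_splits)
qed

definition tripod_rays :: "'a \<Rightarrow> 'a \<Rightarrow> real \<Rightarrow> bool" where
  "tripod_rays f c E \<longleftrightarrow> c \<in> carrier G \<and>
     (\<forall>(m::nat) (n::nat). gp \<one> (f [^] n) (c \<otimes> f [^] m) \<le> E \<and> gp \<one> (inv (f [^] n)) (c \<otimes> f [^] m) \<le> E)"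

text \<open>Each end of the axis of \<open>f\<close> is followed by at most one of three well
  separated directions, so some \<open>x\<close> follows neither. The axis translated by
  \<open>x\<close> has a half that does not turn back towards \<open>\<one>\<close>, and that half
  keeps the direction of \<open>x\<close>. If it is the negative half, \<open>inv f\<close> takes
  the place of \<open>f\<close>.\<close>

lemma ex_tripod_rays:
  assumes directions: "\<And>R. \<exists>a\<in>carrier G. \<exists>b\<in>carrier G. \<exists>c\<in>carrier G.
      R < D \<one> a \<and> R < D \<one> b \<and> R < D \<one> c \<and> gp \<one> a b \<le> C \<and> gp \<one> a c \<le> C \<and> gp \<one> b c \<le> C"
  shows "\<exists>f c E \<tau>. quasi_axis f E \<tau> \<and> tripod_rays f c E"
proof -
  obtain f E \<tau> where ax: "quasi_axis f E \<tau>"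
    using directions[of "4 * C + 20 * \<delta>"] ex_quasi_axis[of _ _ C] by blast
  note ax' = quasi_axis_inv[OF ax]
  note f = quasi_axisD(1)[OF ax]
  have E: "0 \<le> E" using quasi_axisD(3)[OF ax, of 0 0] by (simp add: gromov_product_def D_self)
  \<comment> \<open>\<open>Q\<close> is the overlap beyond which \<open>quasi_axis_separates\<close>
    applies; the distances required below leave the extra room that \<open>translated_ray\<close>
    asks for.\<close>
  define Q where "Q = C + E + 2 * \<delta>"
  obtain a b c where G: "a \<in> carrier G" "b \<in> carrier G" "c \<in> carrier G"
    and far: "Q + (E + \<delta>) + \<delta> < D \<one> a" "Q + (E + \<delta>) + \<delta> < D \<one> b" "Q + (E + \<delta>) + \<delta> < D \<one> c"
    and C: "gp \<one> a b \<le> C" "gp \<one> a c \<le> C" "gp \<one> b c \<le> C"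
    using directions[of "Q + (E + \<delta>) + \<delta>"] by blast
  then have C0: "0 \<le> C" using gp_nonneg[of \<one> a b] by simp
  define P where "P x \<longleftrightarrow> (\<exists>n::nat. Q < gp \<one> x (f [^] n))" for x
  define N where "N x \<longleftrightarrow> (\<exists>n::nat. Q < gp \<one> x (inv f [^] n))" for x
  have P: "\<not> (P x \<and> P y)" if "x \<in> carrier G" "y \<in> carrier G" "gp \<one> x y \<le> C" for x y
    using quasi_axis_separates[OF ax that(1,2) E that(3)] unfolding P_def Q_def by blast
  have N: "\<not> (N x \<and> N y)" if "x \<in> carrier G" "y \<in> carrier G" "gp \<one> x y \<le> C" for x y
    using quasi_axis_separates[OF ax' that(1,2) E that(3)] unfolding N_def Q_def by blast
  have "\<exists>x\<in>{a, b, c}. \<not> P x \<and> \<not> N x"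
    using P[of a b] P[of a c] P[of b c] N[of a b] N[of a c] N[of b c] G C by auto
  then obtain x where xabc: "x \<in> {a, b, c}" "\<not> P x" "\<not> N x" by blast
  then have x: "x \<in> carrier G" "Q + (E + \<delta>) + \<delta> < D \<one> x" using G far by auto
  have PN: "gp \<one> x (f [^] n) \<le> Q" "gp \<one> x (inv (f [^] n)) \<le> Q" for n :: nat
    using xabc(2,3) f unfolding P_def N_def by (simp_all add: not_less nat_pow_inv)
  \<comment> \<open>The two halves of the axis diverge at \<open>\<one>\<close>, so
    \<open>inv x\<close> cannot follow both.\<close>
  have sign: "(\<forall>n::nat. gp \<one> (inv x) (f [^] n) \<le> E + \<delta>) \<or> (\<forall>n::nat. gp \<one> (inv x) (inv (f [^] n)) \<le> E + \<delta>)"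
  proof (rule ccontr)
    assume "\<not> ?thesis"
    then obtain m n :: nat where "E + \<delta> < gp \<one> (inv x) (f [^] n)" "E + \<delta> < gp \<one> (inv x) (inv (f [^] m))"
      by (auto simp: not_le)
    then show False
      using four_point[of \<one> "inv (f [^] m)" "inv x" "f [^] n"] quasi_axisD(3)[OF ax, of m n] x(1) f
        gp_commute[of \<one> "inv x" "inv (f [^] m)"] by (auto simp: min_def split: if_splits)
  qed
  have rays: "gp \<one> z (x \<otimes> y) \<le> Q + \<delta>"
    if "gp \<one> (inv x) y \<le> E + \<delta>" "y \<in> carrier G" "gp \<one> x z \<le> Q" "z \<in> carrier G" for y z
    by (rule translated_ray[OF x(1) that(2,4,1,3) x(2)])
  \<comment> \<open>The constant is enlarged so that one value serves both the axis and the third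
    ray.\<close>
  have mono: "quasi_axis g (Q + \<delta>) \<tau>" if "quasi_axis g E \<tau>" for g
  proof -
    have "E \<le> Q + \<delta>" using C0 delta_pos by (simp add: Q_def)
    then show ?thesis
      unfolding quasi_axis_def using quasi_axisD[OF that] order_trans[OF quasi_axisD(3)[OF that]] by blast
  qed
  from sign have "tripod_rays f x (Q + \<delta>) \<or> tripod_rays (inv f) x (Q + \<delta>)"
  proof
    assume "\<forall>n::nat. gp \<one> (inv x) (f [^] n) \<le> E + \<delta>"
    then have "tripod_rays f x (Q + \<delta>)" unfolding tripod_rays_def using rays PN x(1) f by simp
    then show ?thesis ..
  next
    assume "\<forall>n::nat. gp \<one> (inv x) (inv (f [^] n)) \<le> E + \<delta>"
    then have "tripod_rays (inv f) x (Q + \<delta>)"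
      unfolding tripod_rays_def using rays PN x(1) f by (simp add: nat_pow_inv)
    then show ?thesis ..
  qed
  then show ?thesis using mono[OF ax] mono[OF ax'] by blast
qed

text \<open>The displacement allowed at the ends of the tripod grows with \<open>m\<close>, but
  \<open>tripod_centre_displacement\<close> bounds the one at \<open>\<one>\<close> by
  \<open>\<Delta>\<close>, and \<open>displacement_along\<close> carries this to a fixed
  \<open>f [^] j\<close>. The finite set consists of the elements moving both \<open>\<one>\<close>
  and \<open>f [^] j\<close> by at most \<open>\<epsilon>\<close>.\<close>

lemma coarse_stabilizer_finite:
  assumes ax: "quasi_axis f E \<tau>" and c: "tripod_rays f c E"
    and acyl: "\<And>\<epsilon>. 0 < \<epsilon> \<Longrightarrow> \<exists>R. \<forall>x\<in>carrier G. \<forall>y\<in>carrier G. R \<le> D x y \<longrightarrow>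
      finite {k \<in> carrier G. D x (k \<otimes> x) \<le> \<epsilon> \<and> D y (k \<otimes> y) \<le> \<epsilon>}"
  obtains F m0 where "finite F"
    "\<forall>k\<in>carrier G. \<forall>m\<ge>m0. (\<forall>x\<in>{\<one>, f [^] m, inv (f [^] m), c \<otimes> f [^] m}. D x (k \<otimes> x) \<le> \<tau> / 4 * real m)
      \<longrightarrow> k \<in> F"
proof -
  note f = quasi_axisD(1)[OF ax] and \<tau> = quasi_axisD(2)[OF ax]
  have cG: "c \<in> carrier G" using c unfolding tripod_rays_def by blast
  have E: "0 \<le> E" using quasi_axisD(3)[OF ax, of 0 0] by (simp add: gromov_product_def D_self)
  define \<Delta> where "\<Delta> = 2 * E + 4 * \<delta>"
  define \<epsilon> where "\<epsilon> = 2 * E + 5 * \<Delta> + 4 * \<delta>"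
  have pos: "0 < \<Delta>" "\<Delta> \<le> \<epsilon>" "0 < \<epsilon>" using E delta_pos by (auto simp: \<Delta>_def \<epsilon>_def)
  obtain R where R: "\<forall>x\<in>carrier G. \<forall>y\<in>carrier G. R \<le> D x y \<longrightarrow>
      finite {k \<in> carrier G. D x (k \<otimes> x) \<le> \<epsilon> \<and> D y (k \<otimes> y) \<le> \<epsilon>}"
    using acyl[OF pos(3)] by (rule exE)
  \<comment> \<open>By linear speed, \<open>f [^] j\<close> is far enough from \<open>\<one>\<close>
    for acylindricity to apply to the pair.\<close>
  obtain j :: nat where "R / \<tau> \<le> real j" using real_arch_simple by blast
  then have "R \<le> \<tau> * real j" using \<tau> by (simp add: field_simps)
  then have j: "R \<le> D \<one> (f [^] j)" using quasi_axisD(4)[OF ax, of j] by simp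
  let ?y = "f [^] j"
  \<comment> \<open>From \<open>m1\<close> on, half of the guaranteed distance
    \<open>\<tau> * real m\<close> absorbs all constants, while the displacement uses only a quarter
    of it.\<close>
  obtain m1 :: nat where "(D \<one> c + E + 2 * \<delta> + \<Delta> + D \<one> ?y + 1) * 2 / \<tau> \<le> real m1"
    using real_arch_simple by blast
  then have m1: "D \<one> c + E + 2 * \<delta> + \<Delta> + D \<one> ?y + 1 \<le> \<tau> / 2 * real m1"
    using \<tau> by (simp add: field_simps)
  show thesis
  proof (rule that)
    show "finite {k \<in> carrier G. D \<one> (k \<otimes> \<one>) \<le> \<epsilon> \<and> D ?y (k \<otimes> ?y) \<le> \<epsilon>}"
      using R[rule_format, of \<one> ?y] j f by simp
  next
    show "\<forall>k\<in>carrier G. \<forall>m\<ge>max m1 j.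
      (\<forall>x\<in>{\<one>, f [^] m, inv (f [^] m), c \<otimes> f [^] m}. D x (k \<otimes> x) \<le> \<tau> / 4 * real m) \<longrightarrow>
      k \<in> {k \<in> carrier G. D \<one> (k \<otimes> \<one>) \<le> \<epsilon> \<and> D ?y (k \<otimes> ?y) \<le> \<epsilon>}"
    proof (intro ballI allI impI)
      fix k m
      assume k: "k \<in> carrier G" and m: "max m1 j \<le> m"
        and small: "\<forall>x\<in>{\<one>, f [^] m, inv (f [^] m), c \<otimes> f [^] m}. D x (k \<otimes> x) \<le> \<tau> / 4 * real m"
      let ?e = "\<tau> / 4 * real m"
      have e: "D \<one> k \<le> ?e" "D (f [^] m) (k \<otimes> f [^] m) \<le> ?e"
        "D (inv (f [^] m)) (k \<otimes> inv (f [^] m)) \<le> ?e" "D (c \<otimes> f [^] m) (k \<otimes> (c \<otimes> f [^] m)) \<le> ?e"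
        using small k by simp_all
      have "\<tau> / 2 * real m1 \<le> \<tau> / 2 * real m" using m \<tau> by simp
      then have big: "D \<one> c + E + 2 * \<delta> + \<Delta> + D \<one> ?y + 1 \<le> \<tau> / 2 * real m" using m1 by linarith
      have f1: "\<tau> * real m \<le> D \<one> (f [^] m)" using quasi_axisD(4)[OF ax] .
      then have f2: "\<tau> * real m \<le> D \<one> (inv (f [^] m))" using f by (simp add: D_one_inv)
      have "D c (c \<otimes> f [^] m) = D \<one> (f [^] m)" using D_left[of c \<one> "f [^] m"] cG f by simp
      then have f3: "\<tau> * real m - D \<one> c \<le> D \<one> (c \<otimes> f [^] m)"
        using f1 D_triangle[of c \<one> "c \<otimes> f [^] m"] D_commute[of c \<one>] cG f by simp
      have nn: "0 \<le> D \<one> c" "0 \<le> D \<one> ?y" "0 \<le> ?e" using D_nonneg cG f \<tau> by auto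
      have "D \<one> k \<le> \<Delta>" unfolding \<Delta>_def
      proof (rule tripod_centre_displacement[OF k _ _ _ _ _ _ e])
        show "gp \<one> (f [^] m) (inv (f [^] m)) \<le> E"
          using quasi_axisD(3)[OF ax, of m m] by (simp add: gp_commute)
        show "gp \<one> (f [^] m) (c \<otimes> f [^] m) \<le> E" "gp \<one> (inv (f [^] m)) (c \<otimes> f [^] m) \<le> E"
          using c unfolding tripod_rays_def by blast+
        show "?e + E + 2 * \<delta> < D \<one> (f [^] m)" "?e + E + 2 * \<delta> < D \<one> (inv (f [^] m))"
          "?e + E + 2 * \<delta> < D \<one> (c \<otimes> f [^] m)" using f1 f2 f3 big nn pos by simp_all
      qed (use f cG in auto)
      moreover have "D ?y (k \<otimes> ?y) \<le> \<epsilon>" unfolding \<epsilon>_def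
      proof (rule displacement_along[OF k _ _ _ _ e(2)])
        show "gp ?y \<one> (f [^] m) \<le> E" using quasi_axis_between[OF ax] m by simp
        show "D \<one> ?y + ?e + \<Delta> \<le> D \<one> (f [^] m)" using f1 big nn pos E delta_pos by simp
      qed (use f E pos \<open>D \<one> k \<le> \<Delta>\<close> in auto)
      ultimately show "k \<in> {k \<in> carrier G. D \<one> (k \<otimes> \<one>) \<le> \<epsilon> \<and> D ?y (k \<otimes> ?y) \<le> \<epsilon>}"
        using k pos by simp
    qed
  qed
qed

end

section \<open>Limit points\<close>

context Metric_space
begin

lemma gromov_rel_iff:
  "(u, v) \<in> gromov_rel M d \<longleftrightarrow> range u \<subseteq> M \<and> range v \<subseteq> M \<and>
     (\<forall>b\<in>M. \<forall>T. \<exists>N. \<forall>i\<ge>N. \<forall>j\<ge>N. T \<le> gromov_product d b (u i) (v j))"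
proof -
  have "eventually (\<lambda>(i, j). T \<le> gromov_product d b (u i) (v j)) (sequentially \<times>\<^sub>F sequentially) \<longleftrightarrow>
      (\<exists>N. \<forall>i\<ge>N. \<forall>j\<ge>N. T \<le> gromov_product d b (u i) (v j))" for b T
    unfolding eventually_prod_sequentially by auto
  then show ?thesis
    unfolding gromov_rel_def by (simp add: filterlim_at_top case_prod_unfold)
qed

lemma gromov_relI:
  assumes "range u \<subseteq> M" "range v \<subseteq> M"
    and "\<And>b T. b \<in> M \<Longrightarrow> \<exists>N. \<forall>i\<ge>N. \<forall>j\<ge>N. T \<le> gromov_product d b (u i) (v j)"
  shows "(u, v) \<in> gromov_rel M d"
  unfolding gromov_rel_iff using assms by simp

lemma gromov_relD:
  assumes "(u, v) \<in> gromov_rel M d"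
  shows "range u \<subseteq> M" "range v \<subseteq> M"
    and "b \<in> M \<Longrightarrow> \<exists>N. \<forall>i\<ge>N. \<forall>j\<ge>N. T \<le> gromov_product d b (u i) (v j)"
  using assms unfolding gromov_rel_iff by simp_all

lemma gromov_rel_sym:
  assumes "(u, v) \<in> gromov_rel M d"
  shows "(v, u) \<in> gromov_rel M d"
proof -
  have "\<exists>N. \<forall>i\<ge>N. \<forall>j\<ge>N. T \<le> gromov_product d b (v i) (u j)" if b: "b \<in> M" for b T
  proof -
    have comm: "gromov_product d b (u j) (v i) = gromov_product d b (v i) (u j)" for i j
      by (rule gromov_product_commute) (rule commute)
    obtain N where "\<forall>i\<ge>N. \<forall>j\<ge>N. T \<le> gromov_product d b (u i) (v j)"
      using gromov_relD(3)[OF assms b] by blast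
    then have "T \<le> gromov_product d b (v i) (u j)" if "N \<le> i" "N \<le> j" for i j
      using that comm[of j i] by metis
    then show ?thesis by blast
  qed
  then show ?thesis using gromov_relD(1,2)[OF assms] by (intro gromov_relI)
qed

lemma gromov_product_base_change:
  "\<lbrakk>x \<in> M; y \<in> M; b \<in> M; b' \<in> M\<rbrakk> \<Longrightarrow> gromov_product d b x y \<le> gromov_product d b' x y + d b b'"
  using triangle[of x b' b] triangle[of y b' b] commute[of b b']
  by (simp add: gromov_product_def field_simps)

lemma gromov_product_move:
  "\<lbrakk>x \<in> M; y \<in> M; b \<in> M; x' \<in> M; y' \<in> M\<rbrakk> \<Longrightarrow>
    gromov_product d b x' y' \<le> gromov_product d b x y + d x x' + d y y'"
  using triangle[of x' x b] triangle[of y' y b] triangle[of x x' y] triangle[of x' y' y]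
    commute[of x' x] commute[of y' y]
  by (simp add: gromov_product_def field_simps)

lemma gromov_rel_trans:
  assumes hyp: "hyperbolic_space M d \<delta>" "0 \<le> \<delta>"
    and uv: "(u, v) \<in> gromov_rel M d" and vw: "(v, w) \<in> gromov_rel M d"
  shows "(u, w) \<in> gromov_rel M d"
proof -
  have "\<exists>N. \<forall>i\<ge>N. \<forall>j\<ge>N. T \<le> gromov_product d b (u i) (w j)" if b: "b \<in> M" for b T
  proof -
    obtain N1 where N1: "\<And>i j. \<lbrakk>N1 \<le> i; N1 \<le> j\<rbrakk> \<Longrightarrow> T + (3 * \<delta> + 2) \<le> gromov_product d b (u i) (v j)"
      using gromov_relD(3)[OF uv b] by meson
    obtain N2 where N2: "\<And>i j. \<lbrakk>N2 \<le> i; N2 \<le> j\<rbrakk> \<Longrightarrow> T + (3 * \<delta> + 2) \<le> gromov_product d b (v i) (w j)"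
      using gromov_relD(3)[OF vw b] by meson
    have M: "u i \<in> M" "v i \<in> M" "w i \<in> M" for i
      using gromov_relD(1,2)[OF uv] gromov_relD(2)[OF vw] by auto
    have "T \<le> gromov_product d b (u i) (w j)" if "max N1 N2 \<le> i" "max N1 N2 \<le> j" for i j
      using four_point_condition[OF hyp M(1)[of i] M(2)[of i] M(3)[of j] b] N1[of i i] N2[of i j] that
      by (auto simp: min_def split: if_splits)
    then show ?thesis by blast
  qed
  then show ?thesis using gromov_relD(1)[OF uv] gromov_relD(2)[OF vw] by (intro gromov_relI)
qed

lemma boundary_sequence:
  assumes "\<xi> \<in> gromov_boundary M d" "u \<in> \<xi>"
  shows "range u \<subseteq> M" "(u, u) \<in> gromov_rel M d"
  using assms unfolding gromov_boundary_def quotient_def gromov_sequences_def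
  by (auto simp: gromov_rel_iff)

lemma boundary_sequence_unbounded:
  assumes "\<xi> \<in> gromov_boundary M d" "u \<in> \<xi>" "p \<in> M"
  obtains N where "\<And>i. N \<le> i \<Longrightarrow> T \<le> d p (u i)"
proof -
  obtain N where "\<And>i j. \<lbrakk>N \<le> i; N \<le> j\<rbrakk> \<Longrightarrow> T \<le> gromov_product d p (u i) (u j)"
    using gromov_relD(3)[OF boundary_sequence(2)[OF assms(1,2)] assms(3)] by meson
  moreover have "gromov_product d p (u i) (u i) = d p (u i)" for i
  proof -
    have "u i \<in> M" using boundary_sequence(1)[OF assms(1,2)] by auto
    then show ?thesis using commute[of p "u i"] by (simp add: gromov_product_def)
  qed
  ultimately show thesis using that by metis
qed

text \<open>Inequivalence of \<open>u\<close> and \<open>v\<close> gives only some base point and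
  arbitrarily late indices with a small product. As both sequences converge to infinity, the
  four-point condition spreads this to a bound for all late indices.\<close>

lemma boundary_points_separated:
  assumes hyp: "hyperbolic_space M d \<delta>" "0 \<le> \<delta>"
    and \<xi>: "\<xi> \<in> gromov_boundary M d" "u \<in> \<xi>" and \<eta>: "\<eta> \<in> gromov_boundary M d" "v \<in> \<eta>"
    and "\<xi> \<noteq> \<eta>" and p: "p \<in> M"
  obtains C N where "\<And>i j. \<lbrakk>N \<le> i; N \<le> j\<rbrakk> \<Longrightarrow> gromov_product d p (u i) (v j) \<le> C"
proof -
  note u = boundary_sequence[OF \<xi>] and v = boundary_sequence[OF \<eta>]
  have M: "u i \<in> M" "v i \<in> M" for i using u v by auto
  have "(u, v) \<notin> gromov_rel M d"
  proof
    assume uv: "(u, v) \<in> gromov_rel M d"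
    obtain x where x: "\<xi> = (gromov_rel M d \<inter> gromov_sequences M d \<times> gromov_sequences M d) `` {x}"
      using \<xi>(1) unfolding gromov_boundary_def quotient_def by blast
    obtain y where y: "\<eta> = (gromov_rel M d \<inter> gromov_sequences M d \<times> gromov_sequences M d) `` {y}"
      using \<eta>(1) unfolding gromov_boundary_def quotient_def by blast
    have xy: "(x, u) \<in> gromov_rel M d" "(y, v) \<in> gromov_rel M d"
      "x \<in> gromov_sequences M d" "y \<in> gromov_sequences M d" using x y \<xi>(2) \<eta>(2) by auto
    have "(x, v) \<in> gromov_rel M d" using gromov_rel_trans[OF hyp xy(1) uv] .
    then have xy': "(x, y) \<in> gromov_rel M d"
      using gromov_rel_trans[OF hyp] gromov_rel_sym[OF xy(2)] by blast
    have "(x, z) \<in> gromov_rel M d \<longleftrightarrow> (y, z) \<in> gromov_rel M d" for z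
      using gromov_rel_trans[OF hyp xy'] gromov_rel_trans[OF hyp gromov_rel_sym[OF xy']] by blast
    then have "\<xi> = \<eta>" unfolding x y using xy(3,4) by auto
    with \<open>\<xi> \<noteq> \<eta>\<close> show False ..
  qed
  then obtain b T where b: "b \<in> M"
    and bT: "\<not> (\<exists>N. \<forall>i\<ge>N. \<forall>j\<ge>N. T \<le> gromov_product d b (u i) (v j))"
    using gromov_relI[OF u(1) v(1)] by blast
  \<comment> \<open>\<open>d p b\<close> pays for moving the base point to \<open>p\<close>, the
    last summand for two uses of the four-point condition.\<close>
  define T' where "T' = T + d p b + 2 * (3 * \<delta> + 2)"
  obtain N1 where N1: "\<And>i j. \<lbrakk>N1 \<le> i; N1 \<le> j\<rbrakk> \<Longrightarrow> T' \<le> gromov_product d p (u i) (u j)"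
    using gromov_relD(3)[OF u(2) p] by meson
  obtain N2 where N2: "\<And>i j. \<lbrakk>N2 \<le> i; N2 \<le> j\<rbrakk> \<Longrightarrow> T' \<le> gromov_product d p (v i) (v j)"
    using gromov_relD(3)[OF v(2) p] by meson
  obtain i0 j0 where ij0: "max N1 N2 \<le> i0" "max N1 N2 \<le> j0" "gromov_product d b (u i0) (v j0) < T"
    using bT by (metis not_le)
  have 0: "gromov_product d p (u i0) (v j0) < T + d p b"
    using gromov_product_base_change[OF M(1)[of i0] M(2)[of j0] p b] ij0(3) by linarith
  have "gromov_product d p (u i) (v j) \<le> T'" if ij: "max N1 N2 \<le> i" "max N1 N2 \<le> j" for i j
  proof (rule ccontr)
    assume "\<not> ?thesis"
    then have 1: "T' - (3 * \<delta> + 2) \<le> gromov_product d p (u i0) (v j)"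
      using four_point_condition[OF hyp M(1)[of i0] M(1)[of i] M(2)[of j] p] N1[of i0 i] ij ij0
      by (auto simp: min_def split: if_splits)
    then have "T' - 2 * (3 * \<delta> + 2) \<le> gromov_product d p (u i0) (v j0)"
      using four_point_condition[OF hyp M(1)[of i0] M(2)[of j] M(2)[of j0] p] N2[of j j0] ij ij0
        \<open>0 \<le> \<delta>\<close> by (auto simp: min_def split: if_splits)
    then show False using 0 unfolding T'_def by simp
  qed
  then show thesis using that by blast
qed

end

text \<open>The orbit reaching a limit point may be that of another point \<open>q\<close>; by
  isometry, replacing \<open>q\<close> by \<open>p\<close> costs at most
  \<open>d q p\<close>.\<close>

lemma (in Metric_space) limit_point_sequence:
  assumes act: "isometric_action G M d \<alpha>" and \<xi>: "\<xi> \<in> limit_set G M d \<alpha>" and p: "p \<in> M"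
  obtains u g B where "\<xi> \<in> gromov_boundary M d" "u \<in> \<xi>" "\<And>i::nat. g i \<in> carrier G"
    "\<And>i. d (u i) (\<alpha> (g i) p) \<le> B"
proof -
  obtain q u where q: "\<xi> \<in> gromov_boundary M d" "q \<in> M" "u \<in> \<xi>" "range u \<subseteq> orbit G \<alpha> q"
    using \<xi> unfolding limit_set_def by blast
  then have "\<forall>i. \<exists>g. g \<in> carrier G \<and> u i = \<alpha> g q" unfolding orbit_def by blast
  then obtain g where g: "\<And>i. g i \<in> carrier G" "\<And>i. u i = \<alpha> (g i) q" by metis
  have "d (u i) (\<alpha> (g i) p) \<le> d q p" for i
    using act g q(2) p unfolding isometric_action_def by simp
  with that q g(1) show thesis by blast
qed

text \<open>Three distinct limit points are approached by sequences whose pairwise products stay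
  bounded. Passing to nearby points of the orbit of \<open>p\<close> changes the products by a
  constant, and a late common index makes all three points far away.\<close>

lemma (in Metric_space) ex_directions:
  assumes hyp: "hyperbolic_space M d \<delta>" "0 \<le> \<delta>" and act: "isometric_action G M d \<alpha>"
    and ne: "non_elementary G M d \<alpha>" and p: "p \<in> M"
  obtains C where "\<And>R. \<exists>a\<in>carrier G. \<exists>b\<in>carrier G. \<exists>c\<in>carrier G.
      R < d p (\<alpha> a p) \<and> R < d p (\<alpha> b p) \<and> R < d p (\<alpha> c p) \<and>
      gromov_product d p (\<alpha> a p) (\<alpha> b p) \<le> C \<and> gromov_product d p (\<alpha> a p) (\<alpha> c p) \<le> C \<and>
      gromov_product d p (\<alpha> b p) (\<alpha> c p) \<le> C"
proof -
  let ?L = "limit_set G M d \<alpha>"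
  have "\<exists>T\<subseteq>?L. card T = 3"
  proof (cases "finite ?L")
    case True
    then have "3 \<le> card ?L" using ne unfolding non_elementary_def by simp
    then show ?thesis using obtain_subset_with_card_n by metis
  next
    case False
    then show ?thesis using infinite_arbitrarily_large by metis
  qed
  then obtain T where T: "T \<subseteq> ?L" "card T = 3" by blast
  obtain \<xi> \<eta> \<zeta> where "T = {\<xi>, \<eta>, \<zeta>}" and dist: "\<xi> \<noteq> \<eta>" "\<xi> \<noteq> \<zeta>" "\<eta> \<noteq> \<zeta>"
    using T(2) unfolding card_3_iff by auto
  then have L: "\<xi> \<in> ?L" "\<eta> \<in> ?L" "\<zeta> \<in> ?L" using T(1) by auto
  obtain u g B where u: "\<xi> \<in> gromov_boundary M d" "u \<in> \<xi>" "\<And>i::nat. g i \<in> carrier G"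
      "\<And>i. d (u i) (\<alpha> (g i) p) \<le> B" by (rule limit_point_sequence[OF act L(1) p]) blast
  obtain v h B' where v: "\<eta> \<in> gromov_boundary M d" "v \<in> \<eta>" "\<And>i::nat. h i \<in> carrier G"
      "\<And>i. d (v i) (\<alpha> (h i) p) \<le> B'" by (rule limit_point_sequence[OF act L(2) p]) blast
  obtain w k B'' where w: "\<zeta> \<in> gromov_boundary M d" "w \<in> \<zeta>" "\<And>i::nat. k i \<in> carrier G"
      "\<And>i. d (w i) (\<alpha> (k i) p) \<le> B''" by (rule limit_point_sequence[OF act L(3) p]) blast
  have inM: "u i \<in> M" "v i \<in> M" "w i \<in> M" for i
    using boundary_sequence(1)[OF u(1,2)] boundary_sequence(1)[OF v(1,2)]
      boundary_sequence(1)[OF w(1,2)] by auto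
  interpret group_action G M \<alpha> using act unfolding isometric_action_def by blast
  have orb: "\<alpha> x p \<in> M" if "x \<in> carrier G" for x using element_image[OF that p] by simp
  obtain C1 N1 where 1: "\<And>i j. \<lbrakk>N1 \<le> i; N1 \<le> j\<rbrakk> \<Longrightarrow> gromov_product d p (u i) (v j) \<le> C1"
    by (rule boundary_points_separated[OF hyp u(1,2) v(1,2) dist(1) p]) blast
  obtain C2 N2 where 2: "\<And>i j. \<lbrakk>N2 \<le> i; N2 \<le> j\<rbrakk> \<Longrightarrow> gromov_product d p (u i) (w j) \<le> C2"
    by (rule boundary_points_separated[OF hyp u(1,2) w(1,2) dist(2) p]) blast
  obtain C3 N3 where 3: "\<And>i j. \<lbrakk>N3 \<le> i; N3 \<le> j\<rbrakk> \<Longrightarrow> gromov_product d p (v i) (w j) \<le> C3"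
    by (rule boundary_points_separated[OF hyp v(1,2) w(1,2) dist(3) p]) blast
  have far: "d p x \<le> d p y + d x y" if "x \<in> M" "y \<in> M" for x y
    using triangle[OF p that(2,1)] commute[of y x] by simp
  show thesis
  proof (rule that)
    fix R
    obtain K1 where K1: "\<And>i. K1 \<le> i \<Longrightarrow> R + B + 1 \<le> d p (u i)"
      by (rule boundary_sequence_unbounded[OF u(1,2) p]) blast
    obtain K2 where K2: "\<And>i. K2 \<le> i \<Longrightarrow> R + B' + 1 \<le> d p (v i)"
      by (rule boundary_sequence_unbounded[OF v(1,2) p]) blast
    obtain K3 where K3: "\<And>i. K3 \<le> i \<Longrightarrow> R + B'' + 1 \<le> d p (w i)"
      by (rule boundary_sequence_unbounded[OF w(1,2) p]) blast
    define i where "i = N1 + N2 + N3 + K1 + K2 + K3"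
    let ?C = "max (C1 + B + B') (max (C2 + B + B'') (C3 + B' + B''))"
    note M = inM[of i] orb[OF u(3)[of i]] orb[OF v(3)[of i]] orb[OF w(3)[of i]]
    note near = u(4)[of i] v(4)[of i] w(4)[of i]
    have "R < d p (\<alpha> (g i) p)" "R < d p (\<alpha> (h i) p)" "R < d p (\<alpha> (k i) p)"
      using far[OF M(1,4)] far[OF M(2,5)] far[OF M(3,6)] near K1[of i] K2[of i] K3[of i]
      by (simp_all add: i_def)
    moreover have "gromov_product d p (\<alpha> (g i) p) (\<alpha> (h i) p) \<le> ?C"
      "gromov_product d p (\<alpha> (g i) p) (\<alpha> (k i) p) \<le> ?C"
      "gromov_product d p (\<alpha> (h i) p) (\<alpha> (k i) p) \<le> ?C"
      using gromov_product_move[OF M(1,2) p M(4,5)] gromov_product_move[OF M(1,3) p M(4,6)]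
        gromov_product_move[OF M(2,3) p M(5,6)] near 1[of i i] 2[of i i] 3[of i i]
      by (simp_all add: i_def max_def)
    ultimately show "\<exists>a\<in>carrier G. \<exists>b\<in>carrier G. \<exists>c\<in>carrier G.
      R < d p (\<alpha> a p) \<and> R < d p (\<alpha> b p) \<and> R < d p (\<alpha> c p) \<and>
      gromov_product d p (\<alpha> a p) (\<alpha> b p) \<le> ?C \<and> gromov_product d p (\<alpha> a p) (\<alpha> c p) \<le> ?C \<and>
      gromov_product d p (\<alpha> b p) (\<alpha> c p) \<le> ?C"
      using u(3)[of i] v(3)[of i] w(3)[of i] by blast
  qed
qed

text \<open>Pulling the metric back along the orbit map of \<open>p\<close> leaves a conclusion
  about the group alone, in which the hyperbolic space no longer occurs.\<close>

lemma acylindrically_hyperbolic_rays: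
  assumes "group G" and "acylindrically_hyperbolic TYPE('x) G"
  obtains D \<delta> f c \<tau> F m0 where "hyperbolic_pseudometric G D \<delta>" "f \<in> carrier G" "c \<in> carrier G"
    "0 < \<tau>" "finite F"
    "\<forall>k\<in>carrier G. \<forall>m\<ge>m0. (\<forall>x\<in>{\<one>\<^bsub>G\<^esub>, f [^]\<^bsub>G\<^esub> m, inv\<^bsub>G\<^esub> (f [^]\<^bsub>G\<^esub> m), c \<otimes>\<^bsub>G\<^esub> f [^]\<^bsub>G\<^esub> m}.
      D x (k \<otimes>\<^bsub>G\<^esub> x) \<le> \<tau> * real m) \<longrightarrow> k \<in> F"
proof -
  obtain M :: "'x set" and d \<delta> \<alpha> where hyp: "hyperbolic_space M d \<delta>" and act: "isometric_action G M d \<alpha>"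
    and acyl: "acylindrical G M d \<alpha>" and ne: "non_elementary G M d \<alpha>"
    using assms(2) unfolding acylindrically_hyperbolic_def by blast
  interpret Metric_space M d using hyp unfolding hyperbolic_space_def by blast
  interpret group G by fact
  interpret group_action G M \<alpha> using act unfolding isometric_action_def by blast
  have "limit_set G M d \<alpha> \<noteq> {}" using ne unfolding non_elementary_def by auto
  then obtain p where p: "p \<in> M" unfolding limit_set_def by blast
  \<comment> \<open>A degenerate triangle with all vertices at \<open>p\<close> shows that the
    thinness constant is nonnegative.\<close>
  obtain I where "geodesic_segment M d p p I" using hyperbolic_spaceD(1)[OF hyp p p] by blast
  then have "0 \<le> \<delta>"
    using hyperbolic_spaceD(2)[OF hyp p p p] geodesic_segment_ends nonneg order_trans by metis
  have orb: "\<alpha> x p \<in> M" if "x \<in> carrier G" for x using element_image[OF that p] by simp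
  have iso: "d (\<alpha> g x) (\<alpha> g y) = d x y" if "g \<in> carrier G" "x \<in> M" "y \<in> M" for g x y
    using act that unfolding isometric_action_def by blast
  have comp: "\<alpha> (g \<otimes>\<^bsub>G\<^esub> x) p = \<alpha> g (\<alpha> x p)" if "g \<in> carrier G" "x \<in> carrier G" for g x
    using composition_rule[OF p that] .
  have one: "\<alpha> \<one>\<^bsub>G\<^esub> p = p" using id_eq_one p by (metis restrict_apply')
  define D where "D x y = d (\<alpha> x p) (\<alpha> y p)" for x y
  have gp: "gromov_product D b x y = gromov_product d (\<alpha> b p) (\<alpha> x p) (\<alpha> y p)" for b x y
    by (simp add: gromov_product_def D_def)
  interpret hyperbolic_pseudometric G D "3 * \<delta> + 2"
    by unfold_locales (use orb \<open>0 \<le> \<delta>\<close> in \<open>auto simp: D_def comp iso gp commute triangle intro: four_point_condition[OF hyp]\<close>)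
  obtain C where C: "\<And>R. \<exists>a\<in>carrier G. \<exists>b\<in>carrier G. \<exists>c\<in>carrier G.
      R < d p (\<alpha> a p) \<and> R < d p (\<alpha> b p) \<and> R < d p (\<alpha> c p) \<and>
      gromov_product d p (\<alpha> a p) (\<alpha> b p) \<le> C \<and> gromov_product d p (\<alpha> a p) (\<alpha> c p) \<le> C \<and>
      gromov_product d p (\<alpha> b p) (\<alpha> c p) \<le> C"
    by (rule ex_directions[OF hyp \<open>0 \<le> \<delta>\<close> act ne p]) blast
  obtain f c E \<tau> where ax: "quasi_axis f E \<tau>" and c: "tripod_rays f c E"
    using ex_tripod_rays[of C] C by (auto simp: D_def one gp)
  have acyl': "\<exists>R. \<forall>x\<in>carrier G. \<forall>y\<in>carrier G. R \<le> D x y \<longrightarrow>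
      finite {k \<in> carrier G. D x (k \<otimes>\<^bsub>G\<^esub> x) \<le> \<epsilon> \<and> D y (k \<otimes>\<^bsub>G\<^esub> y) \<le> \<epsilon>}" if "0 < \<epsilon>" for \<epsilon>
  proof -
    obtain R where R: "\<forall>x\<in>M. \<forall>y\<in>M. R \<le> d x y \<longrightarrow>
        finite {g \<in> carrier G. d x (\<alpha> g x) \<le> \<epsilon> \<and> d y (\<alpha> g y) \<le> \<epsilon>}"
      using acyl \<open>0 < \<epsilon>\<close> unfolding acylindrical_def by meson
    have "{k \<in> carrier G. D x (k \<otimes>\<^bsub>G\<^esub> x) \<le> \<epsilon> \<and> D y (k \<otimes>\<^bsub>G\<^esub> y) \<le> \<epsilon>} =
      {g \<in> carrier G. d (\<alpha> x p) (\<alpha> g (\<alpha> x p)) \<le> \<epsilon> \<and> d (\<alpha> y p) (\<alpha> g (\<alpha> y p)) \<le> \<epsilon>}"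
      if "x \<in> carrier G" "y \<in> carrier G" for x y
      using that by (auto simp: D_def comp)
    then show ?thesis using R orb by (intro exI[of _ R]) (simp add: D_def)
  qed
  obtain F m0 where F: "finite F"
    "\<forall>k\<in>carrier G. \<forall>m\<ge>m0.
      (\<forall>x\<in>{\<one>\<^bsub>G\<^esub>, f [^]\<^bsub>G\<^esub> m, inv\<^bsub>G\<^esub> (f [^]\<^bsub>G\<^esub> m), c \<otimes>\<^bsub>G\<^esub> f [^]\<^bsub>G\<^esub> m}.
      D x (k \<otimes>\<^bsub>G\<^esub> x) \<le> \<tau> / 4 * real m) \<longrightarrow> k \<in> F"
    by (rule coarse_stabilizer_finite[OF ax c acyl']) blast
  show thesis
  proof (rule that[OF hyperbolic_pseudometric_axioms quasi_axisD(1)[OF ax] _ _ F])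
    show "0 < \<tau> / 4" "c \<in> carrier G" using quasi_axisD(2)[OF ax] c unfolding tripod_rays_def by auto
  qed
qed

section \<open>Word length\<close>

locale marked_group = group G for G (structure) +
  fixes S :: "'a set"
  assumes finite_S: "finite S" and S_carrier: "S \<subseteq> carrier G" and generate_S: "generate G S = carrier G"
begin

abbreviation letters :: "'a set" where
  "letters \<equiv> S \<union> m_inv G ` S"

abbreviation len :: "'a \<Rightarrow> nat" where
  "len \<equiv> word_length G S"

abbreviation word_prod :: "'a list \<Rightarrow> 'a" where
  "word_prod w \<equiv> foldr (mult G) w \<one>"

lemma letters_carrier: "letters \<subseteq> carrier G"
  using S_carrier by auto

lemma word_prod_closed: "set w \<subseteq> carrier G \<Longrightarrow> word_prod w \<in> carrier G"
  by (induction w) auto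

lemma word_prod_append:
  "set v \<subseteq> carrier G \<Longrightarrow> set w \<subseteq> carrier G \<Longrightarrow> word_prod (v @ w) = word_prod v \<otimes> word_prod w"
  by (induction v) (auto simp: m_assoc word_prod_closed simp del: foldr_append)

lemma ex_word:
  assumes "x \<in> carrier G"
  shows "\<exists>w. set w \<subseteq> letters \<and> word_prod w = x"
proof -
  have "x \<in> generate G S" using assms generate_S by simp
  then show ?thesis
  proof (induction rule: generate.induct)
    case one
    then show ?case by (intro exI[of _ "[]"]) simp
  next
    case (incl h)
    then show ?case using S_carrier by (intro exI[of _ "[h]"]) auto
  next
    case (inv h)
    then show ?case using S_carrier by (intro exI[of _ "[inv h]"]) auto
  next
    case (eng x y)
    then obtain v w where vw: "set v \<subseteq> letters" "word_prod v = x" "set w \<subseteq> letters" "word_prod w = y"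
      by blast
    then have "word_prod (v @ w) = x \<otimes> y"
      using word_prod_append[of v w] letters_carrier by auto
    then show ?case using vw by (intro exI[of _ "v @ w"]) auto
  qed
qed

lemma len_word_prod_le: "set w \<subseteq> letters \<Longrightarrow> len (word_prod w) \<le> length w"
  unfolding word_length_def by (rule Least_le) blast

lemma shortest_word:
  assumes "x \<in> carrier G"
  obtains w where "set w \<subseteq> letters" "word_prod w = x" "length w = len x"
proof -
  have "\<exists>w. length w = len x \<and> set w \<subseteq> letters \<and> word_prod w = x"
    unfolding word_length_def by (rule LeastI_ex) (use ex_word[OF assms] in blast)
  with that show thesis by blast
qed

lemma len_one: "len \<one> = 0"
  using len_word_prod_le[of "[]"] by simp

lemma len_mult:
  assumes "x \<in> carrier G" "y \<in> carrier G"
  shows "len (x \<otimes> y) \<le> len x + len y"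
proof -
  obtain v where v: "set v \<subseteq> letters" "word_prod v = x" "length v = len x"
    by (rule shortest_word[OF assms(1)])
  obtain w where w: "set w \<subseteq> letters" "word_prod w = y" "length w = len y"
    by (rule shortest_word[OF assms(2)])
  have "word_prod (v @ w) = x \<otimes> y"
    using v w word_prod_append[of v w] letters_carrier by auto
  then show ?thesis using len_word_prod_le[of "v @ w"] v w by auto
qed

text \<open>Spell \<open>x\<close> by a shortest word and add up over its letters. Used for lengths
  of inverses, for images under automorphisms, and to compare \<open>D\<close> with the word
  metric.\<close>

lemma subadditive_le_len:
  fixes l :: "'a \<Rightarrow> real"
  assumes one: "l \<one> \<le> 0" and mult: "\<And>x y. \<lbrakk>x \<in> carrier G; y \<in> carrier G\<rbrakk> \<Longrightarrow> l (x \<otimes> y) \<le> l x + l y"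
    and K: "\<And>s. s \<in> letters \<Longrightarrow> l s \<le> K" and x: "x \<in> carrier G"
  shows "l x \<le> K * real (len x)"
proof -
  have "l (word_prod w) \<le> K * real (length w)" if "set w \<subseteq> letters" for w
    using that
  proof (induction w)
    case Nil
    then show ?case using one by simp
  next
    case (Cons s w)
    have "l (s \<otimes> word_prod w) \<le> l s + l (word_prod w)"
      using Cons.prems letters_carrier by (intro mult word_prod_closed) auto
    then show ?case using Cons.IH Cons.prems K[of s] by (simp add: algebra_simps)
  qed
  moreover obtain w where "set w \<subseteq> letters" "word_prod w = x" "length w = len x"
    by (rule shortest_word[OF x])
  ultimately show ?thesis by metis
qed

lemma len_letter: "s \<in> letters \<Longrightarrow> len s \<le> 1"
  using len_word_prod_le[of "[s]"] letters_carrier by auto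

lemma len_inv_le:
  assumes "x \<in> carrier G"
  shows "len (inv x) \<le> len x"
proof -
  have letter: "inv s \<in> letters" if "s \<in> letters" for s using that S_carrier by auto
  have "real (len (inv x)) \<le> 1 * real (len x)"
  proof (rule subadditive_le_len[where l = "\<lambda>x. real (len (inv x))"])
    show "real (len (inv (x \<otimes> y))) \<le> real (len (inv x)) + real (len (inv y))"
      if "x \<in> carrier G" "y \<in> carrier G" for x y
      using len_mult[of "inv y" "inv x"] that by (simp add: inv_mult_group)
    show "real (len (inv s)) \<le> 1" if "s \<in> letters" for s
      using len_letter[OF letter[OF that]] by simp
  qed (use assms in \<open>auto simp: len_one\<close>)
  then show ?thesis by simp
qed

lemma len_inv: "x \<in> carrier G \<Longrightarrow> len (inv x) = len x"
  using len_inv_le[of x] len_inv_le[of "inv x"] by simp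

lemma len_pow: "x \<in> carrier G \<Longrightarrow> len (x [^] (n::nat)) \<le> n * len x"
proof (induction n)
  case (Suc n)
  then show ?case using len_mult[of "x [^] n" x] by simp
qed (simp add: len_one)

lemma finite_ball: "finite {x \<in> carrier G. len x \<le> n}"
proof (rule finite_subset)
  show "finite (word_prod ` {w. set w \<subseteq> letters \<and> length w \<le> n})"
    using finite_S by (intro finite_imageI finite_lists_length_le) auto
  show "{x \<in> carrier G. len x \<le> n} \<subseteq> word_prod ` {w. set w \<subseteq> letters \<and> length w \<le> n}"
  proof
    fix x assume x: "x \<in> {x \<in> carrier G. len x \<le> n}"
    then obtain w where "set w \<subseteq> letters" "word_prod w = x" "length w = len x"
      using shortest_word[of x] by blast
    then show "x \<in> word_prod ` {w. set w \<subseteq> letters \<and> length w \<le> n}" using x by force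
  qed
qed

lemma hom_eq_on_generators:
  assumes "\<phi> \<in> hom G G" "\<psi> \<in> hom G G" "\<And>s. s \<in> S \<Longrightarrow> \<phi> s = \<psi> s" "x \<in> carrier G"
  shows "\<phi> x = \<psi> x"
proof -
  interpret \<phi>: group_hom G G \<phi> by unfold_locales fact
  interpret \<psi>: group_hom G G \<psi> by unfold_locales fact
  have "x \<in> generate G S" using assms(4) generate_S by simp
  then show ?thesis
  proof (induction rule: generate.induct)
    case (inv h)
    then show ?case using S_carrier assms(3) by auto
  next
    case (eng x y)
    then show ?case using generate_S by simp
  qed (simp_all add: assms(3))
qed

section \<open>Kernels of actions on asymptotic cones\<close>

lemma word_dist_self: "x \<in> carrier G \<Longrightarrow> word_dist G S x x = 0"
  by (simp add: word_dist_def len_one)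

lemma word_dist_commute:
  "x \<in> carrier G \<Longrightarrow> y \<in> carrier G \<Longrightarrow> word_dist G S x y = word_dist G S y x"
  using len_inv[of "inv x \<otimes> y"] by (simp add: word_dist_def inv_mult_group)

lemma word_dist_triangle:
  assumes "x \<in> carrier G" "y \<in> carrier G" "z \<in> carrier G"
  shows "word_dist G S x z \<le> word_dist G S x y + word_dist G S y z"
proof -
  have "inv x \<otimes> y \<otimes> (inv y \<otimes> z) = inv x \<otimes> z"
    using assms by (metis inv_closed inv_solve_left m_assoc m_closed)
  then show ?thesis using len_mult[of "inv x \<otimes> y" "inv y \<otimes> z"] assms by (simp add: word_dist_def)
qed

lemma word_dist_left:
  assumes "g \<in> carrier G" "x \<in> carrier G" "y \<in> carrier G"
  shows "word_dist G S (g \<otimes> x) (g \<otimes> y) = word_dist G S x y"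
proof -
  have "inv (g \<otimes> x) \<otimes> (g \<otimes> y) = inv x \<otimes> y"
  proof -
    have "inv g \<otimes> (g \<otimes> y) = y" using assms by (simp flip: m_assoc)
    then show ?thesis using assms by (simp add: inv_mult_group m_assoc)
  qed
  then show ?thesis by (simp add: word_dist_def)
qed

lemma word_dist_mult_left:
  "x \<in> carrier G \<Longrightarrow> g \<in> carrier G \<Longrightarrow> word_dist G S x (g \<otimes> x) = real (len (inv x \<otimes> g \<otimes> x))"
  by (simp add: word_dist_def m_assoc)

lemma admissible_carrier: "x \<in> admissible G S d \<Longrightarrow> x n \<in> carrier G"
  unfolding admissible_def by auto

text \<open>Quotients by a zero scale are 0 and do no harm here; for Paulin's scale only
  nonnegativity is established later.\<close>

lemma equiv_cone_rel:
  assumes d: "\<And>n. 0 \<le> d n"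
  shows "equiv (admissible G S d) (cone_rel G S \<omega> d)"
proof (rule equivI)
  show "cone_rel G S \<omega> d \<subseteq> admissible G S d \<times> admissible G S d"
    unfolding cone_rel_def by auto
  show "refl_on (admissible G S d) (cone_rel G S \<omega> d)"
    unfolding refl_on_def cone_rel_def by (auto simp: word_dist_self admissible_carrier)
  show "sym (cone_rel G S \<omega> d)"
  proof (rule symI)
    fix x y assume "(x, y) \<in> cone_rel G S \<omega> d"
    then show "(y, x) \<in> cone_rel G S \<omega> d"
      unfolding cone_rel_def using word_dist_commute admissible_carrier by auto
  qed
  show "trans (cone_rel G S \<omega> d)"
  proof (rule transI)
    fix x y z assume xy: "(x, y) \<in> cone_rel G S \<omega> d" and yz: "(y, z) \<in> cone_rel G S \<omega> d"
    then have G: "x n \<in> carrier G" "y n \<in> carrier G" "z n \<in> carrier G" for n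
      unfolding cone_rel_def using admissible_carrier by auto
    have lim: "((\<lambda>n. word_dist G S (x n) (y n) / d n + word_dist G S (y n) (z n) / d n) \<longlongrightarrow> 0 + 0) \<omega>"
      using xy yz unfolding cone_rel_def by (intro tendsto_add) auto
    have "word_dist G S (x n) (z n) / d n \<le> word_dist G S (x n) (y n) / d n + word_dist G S (y n) (z n) / d n"
      for n
      using divide_right_mono[OF word_dist_triangle[OF G] d[of n], of n n n]
      by (simp add: add_divide_distrib)
    then have le: "\<forall>\<^sub>F n in \<omega>. word_dist G S (x n) (z n) / d n \<le>
        word_dist G S (x n) (y n) / d n + word_dist G S (y n) (z n) / d n"
      by (intro always_eventually allI)
    have "\<forall>\<^sub>F n in \<omega>. 0 \<le> word_dist G S (x n) (z n) / d n"
      using d by (intro always_eventually allI) (simp add: word_dist_def)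
    then have "((\<lambda>n. word_dist G S (x n) (z n) / d n) \<longlongrightarrow> 0) \<omega>"
      using tendsto_sandwich[OF _ le tendsto_const lim[unfolded add_0_left]] by blast
    then show "(x, z) \<in> cone_rel G S \<omega> d" using xy yz unfolding cone_rel_def by auto
  qed
qed

text \<open>Left multiplication preserves word distance, so the action is well defined on classes.
  Since the identity of \<open>BijGroup\<close> is the restricted identity map, lying in the kernel
  means fixing every class, which is the pointwise description of the kernel.\<close>

lemma cone_kernel_iff:
  assumes d: "\<And>n. 0 \<le> d n" and \<psi>: "\<And>n. \<psi> n \<in> carrier G \<rightarrow> carrier G"
    and pres: "preserves_admissible G S d \<psi>" and g: "g \<in> carrier G"
  shows "g \<in> cone_kernel G S \<omega> d \<psi> \<longleftrightarrow>
    (\<forall>x\<in>admissible G S d. ((\<lambda>n. real (len (inv (x n) \<otimes> \<psi> n g \<otimes> x n)) / d n) \<longlongrightarrow> 0) \<omega>)"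
proof -
  let ?r = "cone_rel G S \<omega> d" and ?A = "admissible G S d" and ?g = "\<lambda>x n. \<psi> n g \<otimes> x n"
  note eq = equiv_cone_rel[OF d, where \<omega> = \<omega>]
  have gA: "?g x \<in> ?A" if "x \<in> ?A" for x using pres that g unfolding preserves_admissible_def by blast
  have "(\<lambda>x. ?r `` {?g x}) respects ?r"
  proof (rule congruentI)
    fix x y assume xy: "(x, y) \<in> ?r"
    then have A: "x \<in> ?A" "y \<in> ?A" unfolding cone_rel_def by auto
    have "word_dist G S (?g x n) (?g y n) = word_dist G S (x n) (y n)" for n
      using word_dist_left funcset_mem[OF \<psi> g] A admissible_carrier by metis
    then have "(?g x, ?g y) \<in> ?r" using xy gA A unfolding cone_rel_def by simp
    then show "?r `` {?g x} = ?r `` {?g y}" by (rule equiv_class_eq[OF eq])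
  qed
  then have act: "(\<Union>y\<in>?r `` {x}. ?r `` {?g y}) = ?r `` {?g x}" if "x \<in> ?A" for x
    using UN_equiv_class[OF eq _ that] by blast
  have "g \<in> cone_kernel G S \<omega> d \<psi> \<longleftrightarrow> (\<forall>p\<in>?A // ?r. (\<Union>y\<in>p. ?r `` {?g y}) = p)"
    unfolding cone_kernel_def kernel_def BijGroup_def cone_action_def cone_def
    using g by (auto simp: restrict_def fun_eq_iff)
  also have "\<dots> \<longleftrightarrow> (\<forall>x\<in>?A. ?r `` {?g x} = ?r `` {x})"
    using act by (auto simp: quotient_def)
  also have "\<dots> \<longleftrightarrow> (\<forall>x\<in>?A. (x, ?g x) \<in> ?r)"
  proof (rule ball_cong[OF refl])
    fix x assume x: "x \<in> ?A"
    show "?r `` {?g x} = ?r `` {x} \<longleftrightarrow> (x, ?g x) \<in> ?r"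
      using eq_equiv_class_iff[OF eq x gA[OF x]] by (simp only: eq_commute)
  qed
  also have "\<dots> \<longleftrightarrow> (\<forall>x\<in>?A. ((\<lambda>n. real (len (inv (x n) \<otimes> \<psi> n g \<otimes> x n)) / d n) \<longlongrightarrow> 0) \<omega>)"
  proof (rule ball_cong[OF refl])
    fix x assume x: "x \<in> ?A"
    have "word_dist G S (x n) (?g x n) = real (len (inv (x n) \<otimes> \<psi> n g \<otimes> x n))" for n
      using word_dist_mult_left admissible_carrier[OF x] funcset_mem[OF \<psi> g] by simp
    then show "(x, ?g x) \<in> ?r \<longleftrightarrow> ((\<lambda>n. real (len (inv (x n) \<otimes> \<psi> n g \<otimes> x n)) / d n) \<longlongrightarrow> 0) \<omega>"
      unfolding cone_rel_def using x gA[OF x] by simp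
  qed
  finally show ?thesis .
qed

section \<open>The FC-center and test sequences for the kernel\<close>

definition FC_center :: "'a set" where
  "FC_center = {g \<in> carrier G. finite ((\<lambda>x. inv x \<otimes> g \<otimes> x) ` carrier G)}"

lemma FC_center_conj:
  assumes "g \<in> FC_center" "x \<in> carrier G"
  shows "inv x \<otimes> g \<otimes> x \<in> FC_center"
proof -
  have g: "g \<in> carrier G" using assms(1) unfolding FC_center_def by simp
  have "inv y \<otimes> (inv x \<otimes> g \<otimes> x) \<otimes> y = inv (x \<otimes> y) \<otimes> g \<otimes> (x \<otimes> y)" if "y \<in> carrier G" for y
    using that assms(2) g by (simp add: inv_mult_group m_assoc)
  then have "(\<lambda>y. inv y \<otimes> (inv x \<otimes> g \<otimes> x) \<otimes> y) ` carrier G \<subseteq> (\<lambda>x. inv x \<otimes> g \<otimes> x) ` carrier G"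
    using assms(2) by auto
  then show ?thesis using assms g finite_subset unfolding FC_center_def by auto
qed

lemma FC_center_iso:
  assumes "\<psi> \<in> hom G G" "\<psi> ` carrier G = carrier G" "g \<in> FC_center"
  shows "\<psi> g \<in> FC_center"
proof -
  interpret \<psi>: group_hom G G \<psi> by unfold_locales fact
  have g: "g \<in> carrier G" using assms(3) unfolding FC_center_def by simp
  have "(\<lambda>x. inv x \<otimes> \<psi> g \<otimes> x) ` carrier G = (\<lambda>x. inv x \<otimes> \<psi> g \<otimes> x) ` \<psi> ` carrier G"
    using assms(2) by simp
  also have "\<dots> = \<psi> ` (\<lambda>x. inv x \<otimes> g \<otimes> x) ` carrier G"
    unfolding image_image using g by (intro image_cong) simp_all
  finally show ?thesis using assms(3) g unfolding FC_center_def by simp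
qed

text \<open>A sequence of linear growth becomes admissible when read at the index
  \<open>nat \<lceil>d n\<rceil>\<close>. For \<open>d n < 1\<close> the identity is used, since
  there the rounded index is not bounded by a multiple of \<open>d n\<close>; otherwise
  \<open>nat \<lceil>d n\<rceil> + 1\<close> is at most \<open>3 * d n\<close>.\<close>

lemma rescaled_admissible:
  assumes xs: "\<And>m::nat. xs m \<in> carrier G" "\<And>m. real (len (xs m)) \<le> K * (real m + 1)" and "0 \<le> K"
  shows "(\<lambda>n. if d n < 1 then \<one> else xs (nat \<lceil>d n\<rceil>)) \<in> admissible G S d"
proof -
  have "real (len (if d n < 1 then \<one> else xs (nat \<lceil>d n\<rceil>))) / d n \<le> 3 * K" for n
  proof (cases "d n < 1")
    case False
    then have "real (nat \<lceil>d n\<rceil>) + 1 \<le> 3 * d n" by linarith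
    then have "K * (real (nat \<lceil>d n\<rceil>) + 1) \<le> K * (3 * d n)" using \<open>0 \<le> K\<close> mult_left_mono by blast
    then have "real (len (xs (nat \<lceil>d n\<rceil>))) \<le> 3 * K * d n"
      using xs(2)[of "nat \<lceil>d n\<rceil>"] by (simp add: algebra_simps)
    then show ?thesis using False by (simp add: divide_le_eq)
  qed (simp add: len_one \<open>0 \<le> K\<close>)
  then have "\<exists>C. \<forall>n. real (len (if d n < 1 then \<one> else xs (nat \<lceil>d n\<rceil>))) / d n \<le> C" by blast
  then show ?thesis unfolding admissible_def using xs(1) by (simp add: image_subset_iff)
qed

lemma cone_kernel_eventually_small:
  assumes d: "\<And>n. 0 \<le> d n" "filterlim d at_top \<omega>" and \<psi>: "\<And>n. \<psi> n \<in> carrier G \<rightarrow> carrier G"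
    and pres: "preserves_admissible G S d \<psi>" and g: "g \<in> carrier G" "g \<in> cone_kernel G S \<omega> d \<psi>"
    and xs: "\<And>m::nat. xs m \<in> carrier G" "\<And>m. real (len (xs m)) \<le> K * (real m + 1)"
    and "0 \<le> K" "0 < \<eta>"
  shows "\<forall>\<^sub>F n in \<omega>. real (len (inv (xs (nat \<lceil>d n\<rceil>)) \<otimes> \<psi> n g \<otimes> xs (nat \<lceil>d n\<rceil>))) \<le> \<eta> * real (nat \<lceil>d n\<rceil>)"
proof -
  let ?x = "\<lambda>n. if d n < 1 then \<one> else xs (nat \<lceil>d n\<rceil>)"
  have "((\<lambda>n. real (len (inv (?x n) \<otimes> \<psi> n g \<otimes> ?x n)) / d n) \<longlongrightarrow> 0) \<omega>"
    using bspec[OF iffD1[OF cone_kernel_iff[where \<omega> = \<omega> and \<psi> = \<psi> and d = d, OF d(1) \<psi> pres g(1)] g(2)]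
      rescaled_admissible[where d = d, OF xs \<open>0 \<le> K\<close>]] .
  then have "\<forall>\<^sub>F n in \<omega>. real (len (inv (?x n) \<otimes> \<psi> n g \<otimes> ?x n)) / d n < \<eta>"
    using \<open>0 < \<eta>\<close> by (rule order_tendstoD)
  moreover have "\<forall>\<^sub>F n in \<omega>. 1 \<le> d n" using d(2) unfolding filterlim_at_top by blast
  ultimately show ?thesis
  proof eventually_elim
    case (elim n)
    then have "real (len (inv (xs (nat \<lceil>d n\<rceil>)) \<otimes> \<psi> n g \<otimes> xs (nat \<lceil>d n\<rceil>))) \<le> \<eta> * d n"
      by (simp add: divide_less_eq split: if_splits)
    also have "\<dots> \<le> \<eta> * real (nat \<lceil>d n\<rceil>)" using \<open>0 < \<eta>\<close> by (simp add: real_nat_ceiling_ge)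
    finally show ?case .
  qed
qed

text \<open>All that the argument on cones retains of acylindrical hyperbolicity, with displacements
  measured in the word metric.\<close>

definition rigid_rays :: "'a \<Rightarrow> 'a \<Rightarrow> real \<Rightarrow> 'a set \<Rightarrow> bool" where
  "rigid_rays f c \<eta> F \<longleftrightarrow> f \<in> carrier G \<and> c \<in> carrier G \<and> 0 < \<eta> \<and> finite F \<and>
     (\<exists>m0::nat. \<forall>k\<in>carrier G. \<forall>m\<ge>m0.
        (\<forall>x\<in>{\<one>, f [^] m, inv (f [^] m), c \<otimes> f [^] m}. real (len (inv x \<otimes> k \<otimes> x)) \<le> \<eta> * real m)
        \<longrightarrow> k \<in> F)"

text \<open>Finitely many conjugates have bounded length, which \<open>\<eta> * real m\<close>
  exceeds for large \<open>m\<close>.\<close>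

lemma FC_center_subset:
  assumes "rigid_rays f c \<eta> F"
  shows "FC_center \<subseteq> F"
proof
  fix k assume k: "k \<in> FC_center"
  obtain m0 where G: "f \<in> carrier G" "c \<in> carrier G" "0 < \<eta>" "finite F" and F: "\<forall>k\<in>carrier G. \<forall>m\<ge>m0.
        (\<forall>x\<in>{\<one>, f [^] m, inv (f [^] m), c \<otimes> f [^] m}. real (len (inv x \<otimes> k \<otimes> x)) \<le> \<eta> * real m)
        \<longrightarrow> k \<in> F"
    using assms unfolding rigid_rays_def by blast
  have kG: "k \<in> carrier G" using k unfolding FC_center_def by simp
  have fin: "finite (len ` (\<lambda>x. inv x \<otimes> k \<otimes> x) ` carrier G)" using k unfolding FC_center_def by simp
  define B where "B = Max (len ` (\<lambda>x. inv x \<otimes> k \<otimes> x) ` carrier G)"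
  have B: "len (inv x \<otimes> k \<otimes> x) \<le> B" if "x \<in> carrier G" for x
    unfolding B_def using that by (intro Max_ge[OF fin]) auto
  obtain m1 :: nat where "real B / \<eta> \<le> real m1" using real_arch_simple by blast
  then have m1: "real B \<le> \<eta> * real m1" using G(3) by (simp add: field_simps)
  define m where "m = max m0 m1"
  have "\<eta> * real m1 \<le> \<eta> * real m" using G(3) by (simp add: m_def)
  then have small: "\<forall>x\<in>carrier G. real (len (inv x \<otimes> k \<otimes> x)) \<le> \<eta> * real m"
    using B m1 by force
  have "{\<one>, f [^] m, inv (f [^] m), c \<otimes> f [^] m} \<subseteq> carrier G" using G by simp
  then have "\<forall>x\<in>{\<one>, f [^] m, inv (f [^] m), c \<otimes> f [^] m}. real (len (inv x \<otimes> k \<otimes> x)) \<le> \<eta> * real m"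
    using small by blast
  moreover have "m0 \<le> m" by (simp add: m_def)
  ultimately show "k \<in> F" using F kG by blast
qed

text \<open>The four points of \<open>rigid_rays\<close> at
  \<open>m = nat \<lceil>d n\<rceil>\<close> form admissible test sequences. An element of the
  kernel displaces each of them by less than any given multiple of the scale, for most
  \<open>n\<close>.\<close>

lemma cone_kernel_eventually_in:
  assumes d: "\<And>n. 0 \<le> d n" "filterlim d at_top \<omega>" and \<psi>: "\<And>n. \<psi> n \<in> carrier G \<rightarrow> carrier G"
    and pres: "preserves_admissible G S d \<psi>" and g: "g \<in> carrier G" "g \<in> cone_kernel G S \<omega> d \<psi>"
    and F: "rigid_rays f c \<eta> F"
  shows "\<forall>\<^sub>F n in \<omega>. \<psi> n g \<in> F"
proof -
  obtain m0 where G: "f \<in> carrier G" "c \<in> carrier G" "0 < \<eta>" "finite F" and F: "\<forall>k\<in>carrier G. \<forall>m\<ge>m0.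
        (\<forall>x\<in>{\<one>, f [^] m, inv (f [^] m), c \<otimes> f [^] m}. real (len (inv x \<otimes> k \<otimes> x)) \<le> \<eta> * real m)
        \<longrightarrow> k \<in> F"
    using F unfolding rigid_rays_def by blast
  define K where "K = real (len f) + real (len c)"
  note small = cone_kernel_eventually_small[where \<psi> = \<psi> and K = K, OF d \<psi> pres g _ _ _ G(3)]
  have K0: "0 \<le> K" by (simp add: K_def)
  have pow: "real (len (f [^] m)) \<le> real m * real (len f)" for m :: nat
    using len_pow[OF G(1), of m] by (metis of_nat_le_iff of_nat_mult)
  have K: "real m * real (len f) + real (len c) \<le> K * (real m + 1)" for m :: nat
    by (simp add: K_def algebra_simps)
  have K': "real m * real (len f) \<le> K * (real m + 1)" for m :: nat
    using K[of m] by linarith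
  have "\<forall>\<^sub>F n in \<omega>. real (len (inv \<one> \<otimes> \<psi> n g \<otimes> \<one>)) \<le> \<eta> * real (nat \<lceil>d n\<rceil>)"
    using small[of "\<lambda>_. \<one>"] K0 by (simp add: len_one)
  moreover have "\<forall>\<^sub>F n in \<omega>. real (len (inv (f [^] nat \<lceil>d n\<rceil>) \<otimes> \<psi> n g \<otimes> f [^] nat \<lceil>d n\<rceil>)) \<le> \<eta> * real (nat \<lceil>d n\<rceil>)"
    by (rule small) (use G K0 order_trans[OF pow K'] in auto)
  moreover have "\<forall>\<^sub>F n in \<omega>. real (len (inv (inv (f [^] nat \<lceil>d n\<rceil>)) \<otimes> \<psi> n g \<otimes> inv (f [^] nat \<lceil>d n\<rceil>)))
      \<le> \<eta> * real (nat \<lceil>d n\<rceil>)"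
    by (rule small) (use G K0 order_trans[OF pow K'] in \<open>auto simp: len_inv\<close>)
  moreover have "\<forall>\<^sub>F n in \<omega>. real (len (inv (c \<otimes> f [^] nat \<lceil>d n\<rceil>) \<otimes> \<psi> n g \<otimes> (c \<otimes> f [^] nat \<lceil>d n\<rceil>)))
      \<le> \<eta> * real (nat \<lceil>d n\<rceil>)"
  proof (rule small)
    show "real (len (c \<otimes> f [^] m)) \<le> K * (real m + 1)" for m :: nat
      using len_mult[of c "f [^] m"] pow[of m] K[of m] G by simp
  qed (use G K0 in auto)
  moreover have "\<forall>\<^sub>F n in \<omega>. real m0 \<le> d n" using d(2) unfolding filterlim_at_top by blast
  ultimately show ?thesis
  proof eventually_elim
    case (elim n)
    have "m0 \<le> nat \<lceil>d n\<rceil>" using elim(5) by linarith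
    moreover have "\<forall>x\<in>{\<one>, f [^] nat \<lceil>d n\<rceil>, inv (f [^] nat \<lceil>d n\<rceil>), c \<otimes> f [^] nat \<lceil>d n\<rceil>}.
        real (len (inv x \<otimes> \<psi> n g \<otimes> x)) \<le> \<eta> * real (nat \<lceil>d n\<rceil>)"
      using elim(1-4) by simp
    ultimately show ?case using F funcset_mem[OF \<psi> g(1)] by blast
  qed
qed

text \<open>Conjugating by \<open>h\<close> amounts to testing \<open>g\<close> on the sequence
  \<open>\<psi> n h \<otimes> x n\<close>, which is again admissible.\<close>

lemma cone_kernel_conj:
  assumes d: "\<And>n. 0 \<le> d n" and \<psi>: "\<And>n. \<psi> n \<in> hom G G"
    and pres: "preserves_admissible G S d \<psi>" and g: "g \<in> carrier G" "g \<in> cone_kernel G S \<omega> d \<psi>"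
    and h: "h \<in> carrier G"
  shows "inv h \<otimes> g \<otimes> h \<in> cone_kernel G S \<omega> d \<psi>"
proof -
  have \<psi>G: "\<And>n. \<psi> n \<in> carrier G \<rightarrow> carrier G" using \<psi> by (auto simp: hom_def)
  note iff = cone_kernel_iff[where \<omega> = \<omega> and \<psi> = \<psi> and d = d, OF d \<psi>G pres]
  have "((\<lambda>n. real (len (inv (x n) \<otimes> \<psi> n (inv h \<otimes> g \<otimes> h) \<otimes> x n)) / d n) \<longlongrightarrow> 0) \<omega>"
    if x: "x \<in> admissible G S d" for x
  proof -
    have hx: "(\<lambda>n. \<psi> n h \<otimes> x n) \<in> admissible G S d"
      using pres h x unfolding preserves_admissible_def by blast
    have "inv (x n) \<otimes> \<psi> n (inv h \<otimes> g \<otimes> h) \<otimes> x n = inv (\<psi> n h \<otimes> x n) \<otimes> \<psi> n g \<otimes> (\<psi> n h \<otimes> x n)" for n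
    proof -
      interpret \<psi>: group_hom G G "\<psi> n" by unfold_locales (rule \<psi>)
      show ?thesis using g h admissible_carrier[OF x] by (simp add: inv_mult_group m_assoc)
    qed
    then show ?thesis using iff[OF g(1)] g(2) hx by auto
  qed
  then show ?thesis using iff[of "inv h \<otimes> g \<otimes> h"] g h by blast
qed

text \<open>
  Elements of the kernel are eventually sent into \<open>F\<close>, and so are their conjugates. As \<open>\<psi> n\<close> is
  injective, a conjugacy class in the kernel has at most \<open>card F\<close> elements.
\<close>
lemma cone_kernel_eq_FC_center:
  assumes d: "\<And>n. 0 \<le> d n" "filterlim d at_top \<omega>" and "\<omega> \<noteq> bot"
    and \<psi>: "\<And>n. \<psi> n \<in> hom G G" "\<And>n. bij_betw (\<psi> n) (carrier G) (carrier G)"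
    and pres: "preserves_admissible G S d \<psi>" and F: "rigid_rays f c \<eta> F"
  shows "cone_kernel G S \<omega> d \<psi> = FC_center"
proof (intro equalityI subsetI)
  have \<psi>G: "\<And>n. \<psi> n \<in> carrier G \<rightarrow> carrier G" using \<psi>(1) by (auto simp: hom_def)
  have finF: "finite F" using F unfolding rigid_rays_def by blast
  {
    fix g assume ker: "g \<in> cone_kernel G S \<omega> d \<psi>"
    then have g: "g \<in> carrier G" unfolding cone_kernel_def kernel_def by simp
    let ?C = "(\<lambda>x. inv x \<otimes> g \<otimes> x) ` carrier G"
    have "finite ?C"
    proof (rule ccontr)
      assume "infinite ?C"
      then obtain T where T: "T \<subseteq> ?C" "finite T" "card T = Suc (card F)"
        using infinite_arbitrarily_large[of ?C "Suc (card F)"] by blast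
      have "\<forall>\<^sub>F n in \<omega>. \<psi> n t \<in> F" if t: "t \<in> T" for t
      proof -
        have "t \<in> cone_kernel G S \<omega> d \<psi>" "t \<in> carrier G"
          using t T(1) cone_kernel_conj[where \<psi> = \<psi>, OF d(1) \<psi>(1) pres g ker] g by auto
        then show ?thesis by (intro cone_kernel_eventually_in[where \<psi> = \<psi>, OF d \<psi>G pres _ _ F])
      qed
      then have "\<forall>\<^sub>F n in \<omega>. \<forall>t\<in>T. \<psi> n t \<in> F" using T(2) by (intro eventually_ball_finite) auto
      then obtain n where n: "\<forall>t\<in>T. \<psi> n t \<in> F" using \<open>\<omega> \<noteq> bot\<close> eventually_happens' by blast
      have "?C \<subseteq> carrier G" using g by auto
      then have "inj_on (\<psi> n) T"
        using inj_on_subset[OF bij_betw_imp_inj_on[OF \<psi>(2)]] T(1) by blast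
      moreover have "\<psi> n ` T \<subseteq> F" using n by blast
      ultimately have "card T \<le> card F" using finF by (rule card_inj_on_le)
      then show False using T(3) by simp
    qed
    then show "g \<in> FC_center" using g unfolding FC_center_def by simp
  next
    fix g assume FC: "g \<in> FC_center"
    then have g: "g \<in> carrier G" unfolding FC_center_def by simp
    have "((\<lambda>n. real (len (inv (x n) \<otimes> \<psi> n g \<otimes> x n)) / d n) \<longlongrightarrow> 0) \<omega>"
      if x: "x \<in> admissible G S d" for x
    proof -
      \<comment> \<open>Automorphisms and conjugations preserve the FC-center, so for all
        \<open>n\<close> these elements stay in the finite set \<open>F\<close>, and their lengths
        have a bound independent of \<open>n\<close>.\<close>
      have inF: "inv (x n) \<otimes> \<psi> n g \<otimes> x n \<in> F" for n
        using FC_center_conj[OF FC_center_iso[OF \<psi>(1) bij_betw_imp_surj_on[OF \<psi>(2)] FC]]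
          admissible_carrier[OF x] FC_center_subset[OF F] by blast
      define B where "B = Max (len ` F)"
      have B: "len (inv (x n) \<otimes> \<psi> n g \<otimes> x n) \<le> B" for n
        unfolding B_def using finF inF by simp
      have lim: "((\<lambda>n. real B / d n) \<longlongrightarrow> 0) \<omega>"
        using d(2) by (intro tendsto_divide_0[OF tendsto_const] filterlim_at_top_imp_at_infinity)
      show ?thesis
      proof (rule tendsto_sandwich[OF _ _ tendsto_const lim])
        show "\<forall>\<^sub>F n in \<omega>. 0 \<le> real (len (inv (x n) \<otimes> \<psi> n g \<otimes> x n)) / d n"
          using d(1) by (intro always_eventually allI) simp
        show "\<forall>\<^sub>F n in \<omega>. real (len (inv (x n) \<otimes> \<psi> n g \<otimes> x n)) / d n \<le> real B / d n"
          using B d(1) by (intro always_eventually allI divide_right_mono) auto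
      qed
    qed
    then show "g \<in> cone_kernel G S \<omega> d \<psi>"
      using cone_kernel_iff[where \<omega> = \<omega> and \<psi> = \<psi> and d = d, OF d(1) \<psi>G pres g] by blast
  }
qed

end

section \<open>Scales tending to infinity along the ultrafilter\<close>

lemma nonprincipal_ultrafilter_le_sequentially:
  assumes "nonprincipal_ultrafilter \<omega>"
  shows "\<omega> \<le> sequentially"
proof -
  \<comment> \<open>A singleton in the ultrafilter would make it principal. Hence it contains the
    complement of every point, and by induction every tail.\<close>
  have ne: "eventually (\<lambda>n. n \<noteq> i) \<omega>" for i
  proof (rule ccontr)
    assume "\<not> eventually (\<lambda>n. n \<noteq> i) \<omega>"
    then have i: "eventually (\<lambda>n. n = i) \<omega>"
      using assms unfolding nonprincipal_ultrafilter_def by (metis (mono_tags, lifting) eventually_mono)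
    have "eventually P \<omega> \<longleftrightarrow> P i" for P
    proof
      assume "eventually P \<omega>"
      then have "eventually (\<lambda>n. P n \<and> n = i) \<omega>" using i by (rule eventually_conj)
      moreover have "\<omega> \<noteq> bot" using assms unfolding nonprincipal_ultrafilter_def by blast
      ultimately show "P i" using eventually_happens' by blast
    next
      assume "P i"
      then show "eventually P \<omega>" using i by (auto elim: eventually_mono)
    qed
    then have "\<omega> = principal {i}" by (intro filter_eqI) (simp add: eventually_principal)
    then show False using assms unfolding nonprincipal_ultrafilter_def by blast
  qed
  have "eventually (\<lambda>n. N \<le> n) \<omega>" for N
  proof (induction N)
    case (Suc N)
    then show ?case using ne[of N] by eventually_elim simp
  qed simp
  note ev = this
  show ?thesis unfolding le_filter_def
  proof (intro allI impI)
    fix P assume "eventually P sequentially"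
    then obtain N where "\<forall>n\<ge>N. P n" unfolding eventually_sequentially by blast
    then show "eventually P \<omega>" by (intro eventually_mono[OF ev[of N]]) blast
  qed
qed

lemma incseq_unbounded_at_top:
  fixes d :: "nat \<Rightarrow> real"
  assumes "incseq d" "\<not> bdd_above (range d)"
  shows "filterlim d at_top sequentially"
  unfolding filterlim_at_top
proof
  fix Z
  obtain n where "Z \<le> d n"
    using assms(2) unfolding bdd_above_def by (metis (no_types) imageE linear)
  then have "Z \<le> d m" if "n \<le> m" for m using incseqD[OF assms(1) that] by linarith
  then show "eventually (\<lambda>m. Z \<le> d m) sequentially" unfolding eventually_sequentially by blast
qed

section \<open>Representatives of outer automorphisms\<close>

context group
begin

definition conj_map :: "'a \<Rightarrow> 'a \<Rightarrow> 'a" where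
  "conj_map h = (\<lambda>x\<in>carrier G. h \<otimes> x \<otimes> inv h)"

lemma conj_map_auto:
  assumes h: "h \<in> carrier G"
  shows "conj_map h \<in> auto G"
proof -
  have cancel: "h \<otimes> (inv h \<otimes> x) = x" "inv h \<otimes> (h \<otimes> x) = x" if "x \<in> carrier G" for x
    using h that by (simp_all flip: m_assoc)
  have "bij_betw (conj_map h) (carrier G) (carrier G)"
    by (rule bij_betw_byWitness[where f' = "conj_map (inv h)"])
      (use h in \<open>auto simp: conj_map_def m_assoc cancel\<close>)
  moreover have "conj_map h \<in> hom G G"
    using h by (auto simp: hom_def conj_map_def m_assoc cancel)
  ultimately show ?thesis unfolding auto_def Bij_def by (simp add: conj_map_def)
qed

lemma compose_auto:
  assumes "\<phi> \<in> auto G" "\<psi> \<in> auto G"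
  shows "compose (carrier G) \<phi> \<psi> \<in> auto G"
  using assms hom_compose[of \<psi> G \<phi>] compose_Bij unfolding auto_def by auto

lemma AutoGroup_mult:
  assumes "\<phi> \<in> auto G" "\<psi> \<in> auto G"
  shows "\<phi> \<otimes>\<^bsub>AutoGroup G\<^esub> \<psi> = compose (carrier G) \<phi> \<psi>"
  using assms unfolding AutoGroup_def BijGroup_def auto_def by simp

lemma out_class_eq:
  assumes "\<phi> \<in> auto G"
  shows "out_class G \<phi> = (\<lambda>h. compose (carrier G) (conj_map h) \<phi>) ` carrier G"
proof -
  have "Inn G = conj_map ` carrier G" unfolding Inn_def conj_map_def by blast
  then have "out_class G \<phi> = (\<lambda>h. conj_map h \<otimes>\<^bsub>AutoGroup G\<^esub> \<phi>) ` carrier G"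
    unfolding out_class_def r_coset_def by auto
  then show ?thesis using AutoGroup_mult[OF conj_map_auto assms] by simp
qed

lemma conj_map_compose_mult:
  assumes "h \<in> carrier G" "g \<in> carrier G" "\<psi> \<in> auto G"
  shows "compose (carrier G) (conj_map h) (compose (carrier G) (conj_map g) \<psi>) =
    compose (carrier G) (conj_map (h \<otimes> g)) \<psi>"
proof
  fix x
  have "\<psi> x \<in> carrier G" if "x \<in> carrier G" using assms(3) that unfolding auto_def hom_def by auto
  then show "compose (carrier G) (conj_map h) (compose (carrier G) (conj_map g) \<psi>) x =
    compose (carrier G) (conj_map (h \<otimes> g)) \<psi> x"
    using assms(1,2) by (simp add: compose_def conj_map_def m_assoc inv_mult_group)
qed

lemma out_class_conj:
  assumes g: "g \<in> carrier G" and \<psi>: "\<psi> \<in> auto G"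
  shows "out_class G (compose (carrier G) (conj_map g) \<psi>) = out_class G \<psi>"
proof -
  have "out_class G (compose (carrier G) (conj_map g) \<psi>) =
      (\<lambda>h. compose (carrier G) (conj_map (h \<otimes> g)) \<psi>) ` carrier G"
    using out_class_eq[OF compose_auto[OF conj_map_auto[OF g] \<psi>]] conj_map_compose_mult[OF _ g \<psi>] by simp
  also have "\<dots> = (\<lambda>h. compose (carrier G) (conj_map h) \<psi>) ` (\<lambda>h. h \<otimes> g) ` carrier G"
    by (simp add: image_image)
  also have "(\<lambda>h. h \<otimes> g) ` carrier G = carrier G"
  proof (intro equalityI subsetI)
    fix x assume "x \<in> carrier G"
    then have "x = (x \<otimes> inv g) \<otimes> g" "x \<otimes> inv g \<in> carrier G" using g by (simp_all add: m_assoc)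
    then show "x \<in> (\<lambda>h. h \<otimes> g) ` carrier G" by blast
  qed (use g in auto)
  finally show ?thesis using out_class_eq[OF \<psi>] by simp
qed

lemma Out_representative:
  assumes "C \<in> carrier (Out G)"
  obtains \<psi> where "\<psi> \<in> auto G" "out_class G \<psi> = C"
  using assms unfolding Out_def FactGroup_def RCOSETS_def out_class_def
  by (auto simp: AutoGroup_def)

end

section \<open>Minimally displacing representatives and growth of Paulin's scale\<close>

context marked_group
begin

text \<open>Word lengths are natural numbers, so the largest displacement of a generator attains its
  minimum at some \<open>g\<close>. Conjugation by \<open>inv g\<close> moves this point to the
  identity and keeps the outer class.\<close>

lemma ex_minimal_representative:
  assumes "C \<in> carrier (Out G)"
  shows "\<exists>\<phi>\<in>auto G. out_class G \<phi> = C \<and> (\<forall>s\<in>S. real (len (\<phi> s)) \<le> paulin_scale G S \<phi>)"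
proof -
  obtain \<psi> where \<psi>: "\<psi> \<in> auto G" "out_class G \<psi> = C" by (rule Out_representative[OF assms])
  have \<psi>G: "\<psi> x \<in> carrier G" if "x \<in> carrier G" for x using \<psi>(1) that unfolding auto_def hom_def by auto
  define N where "N g = Max ((\<lambda>s. len (inv g \<otimes> \<psi> s \<otimes> g)) ` S)" for g
  obtain g where g: "g \<in> carrier G" and min: "\<And>h. h \<in> carrier G \<Longrightarrow> N g \<le> N h"
    using ex_has_least_nat[of "\<lambda>g. g \<in> carrier G" \<one> N] by auto
  define \<phi> where "\<phi> = compose (carrier G) (conj_map (inv g)) \<psi>"
  have \<phi>: "\<phi> \<in> auto G" "out_class G \<phi> = C"
    unfolding \<phi>_def using compose_auto[OF conj_map_auto \<psi>(1)] out_class_conj[OF _ \<psi>(1)] g \<psi>(2) by auto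
  have \<phi>_eq: "\<phi> x = inv g \<otimes> \<psi> x \<otimes> g" if "x \<in> carrier G" for x
    using that g \<psi>G by (simp add: \<phi>_def compose_def conj_map_def)
  have "real (len (\<phi> s)) \<le> paulin_scale G S \<phi>" if s: "s \<in> S" for s
    unfolding paulin_scale_def
  proof (rule cINF_greatest)
    fix h assume h: "h \<in> carrier G"
    have "len (\<phi> s) \<le> N g"
      unfolding N_def using s S_carrier finite_S \<phi>_eq by (intro Max_ge) auto
    also have "\<dots> \<le> N (g \<otimes> h)" using g h by (intro min) simp
    finally have le: "len (\<phi> s) \<le> N (g \<otimes> h)" .
    have "N (g \<otimes> h) \<in> (\<lambda>s. len (inv (g \<otimes> h) \<otimes> \<psi> s \<otimes> (g \<otimes> h))) ` S"
      unfolding N_def using s finite_S by (intro Max_in) auto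
    then obtain t where t: "t \<in> S" "N (g \<otimes> h) = len (inv (g \<otimes> h) \<otimes> \<psi> t \<otimes> (g \<otimes> h))" by blast
    have tG: "t \<in> carrier G" using t(1) S_carrier by blast
    \<comment> \<open>The displacement of \<open>\<phi>\<close> at \<open>h\<close> is that of
      \<open>\<psi>\<close> at \<open>g \<otimes> h\<close>, where the minimality of
      \<open>g\<close> applies.\<close>
    have "inv (g \<otimes> h) \<otimes> \<psi> t \<otimes> (g \<otimes> h) = inv h \<otimes> (\<phi> t \<otimes> h)"
      using \<phi>_eq[OF tG] \<psi>G[OF tG] g h by (simp add: inv_mult_group m_assoc)
    then have "real (N (g \<otimes> h)) = word_dist G S h (\<phi> t \<otimes> h)" using t(2) by (simp add: word_dist_def)
    also have "\<dots> \<le> Max ((\<lambda>s. word_dist G S h (\<phi> s \<otimes> h)) ` S)"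
      using t(1) finite_S by (intro Max_ge) auto
    finally show "real (len (\<phi> s)) \<le> Max ((\<lambda>s. word_dist G S h (\<phi> s \<otimes> h)) ` S)" using le by simp
  qed auto
  then show ?thesis using \<phi> by blast
qed

lemma auto_len_le:
  assumes \<phi>: "\<phi> \<in> auto G" and L: "\<And>s. s \<in> S \<Longrightarrow> real (len (\<phi> s)) \<le> L" and x: "x \<in> carrier G"
  shows "real (len (\<phi> x)) \<le> L * real (len x)"
proof -
  interpret \<phi>: group_hom G G \<phi> using \<phi> by unfold_locales (simp add: auto_def)
  show ?thesis
  proof (rule subadditive_le_len[where l = "\<lambda>x. real (len (\<phi> x))", OF _ _ _ x])
    show "real (len (\<phi> (x \<otimes> y))) \<le> real (len (\<phi> x)) + real (len (\<phi> y))"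
      if "x \<in> carrier G" "y \<in> carrier G" for x y
      using len_mult[of "\<phi> x" "\<phi> y"] that by simp
    show "real (len (\<phi> s)) \<le> L" if "s \<in> letters" for s
      using that S_carrier L by (auto simp: len_inv subsetD)
  qed (simp add: len_one)
qed

text \<open>An automorphism is determined by its values on \<open>S\<close>, and values of bounded
  length leave finitely many choices. This forces Paulin's scale to infinity.\<close>

lemma finite_bounded_automorphisms:
  fixes \<phi> :: "'i \<Rightarrow> 'a \<Rightarrow> 'a"
  assumes \<phi>: "\<And>i. \<phi> i \<in> auto G" and inj: "inj \<phi>"
  shows "finite {i. \<forall>s\<in>S. len (\<phi> i s) \<le> n}"
proof (rule finite_imageD)
  let ?I = "{i. \<forall>s\<in>S. len (\<phi> i s) \<le> n}"
  have \<phi>G: "\<phi> i x \<in> carrier G" if "x \<in> carrier G" for i x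
    using \<phi>[of i] that unfolding auto_def hom_def by auto
  have "(\<lambda>i. restrict (\<phi> i) S) ` ?I \<subseteq> S \<rightarrow>\<^sub>E {x \<in> carrier G. len x \<le> n}"
    using \<phi>G S_carrier by auto
  then show "finite ((\<lambda>i. restrict (\<phi> i) S) ` ?I)"
    using finite_PiE[of S "\<lambda>_. {x \<in> carrier G. len x \<le> n}"] finite_S finite_ball finite_subset by blast
  show "inj_on (\<lambda>i. restrict (\<phi> i) S) ?I"
  proof (rule inj_onI)
    fix i j assume "restrict (\<phi> i) S = restrict (\<phi> j) S"
    then have S: "\<And>s. s \<in> S \<Longrightarrow> \<phi> i s = \<phi> j s" by (metis restrict_apply')
    \<comment> \<open>Elements of \<open>auto G\<close> are extensional, so agreement on the carrier
      gives equality of functions.\<close>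
    have "\<phi> i = \<phi> j"
    proof (rule extensionalityI)
      show "\<phi> i \<in> extensional (carrier G)" "\<phi> j \<in> extensional (carrier G)"
        using \<phi> Bij_imp_extensional unfolding auto_def by blast+
      show "\<phi> i x = \<phi> j x" if "x \<in> carrier G" for x
        by (rule hom_eq_on_generators[of "\<phi> i" "\<phi> j"]) (use \<phi> S that in \<open>auto simp: auto_def\<close>)
    qed
    then show "i = j" using inj by (simp add: inj_eq)
  qed
qed

text \<open>The scale stays above \<open>d 0\<close>, so the fixed length of \<open>g\<close>
  contributes at most \<open>len g / d 0\<close>.\<close>

lemma preserves_admissible_natural:
  assumes d: "\<And>n. 0 < d n" "incseq d"
  shows "preserves_admissible G S d (\<lambda>n g. g)"
  unfolding preserves_admissible_def
proof (intro ballI)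
  fix g x assume g: "g \<in> carrier G" and x: "x \<in> admissible G S d"
  then obtain C where C: "\<And>n. real (len (x n)) / d n \<le> C" unfolding admissible_def by blast
  have "real (len (g \<otimes> x n)) / d n \<le> real (len g) / d 0 + C" for n
  proof -
    have "real (len (g \<otimes> x n)) / d n \<le> (real (len g) + real (len (x n))) / d n"
      using len_mult[OF g admissible_carrier[OF x, of n]] d(1)[of n] by (intro divide_right_mono) auto
    moreover have "real (len g) / d n \<le> real (len g) / d 0"
      using d incseqD[OF d(2), of 0 n] by (intro divide_left_mono) auto
    ultimately show ?thesis using C[of n] by (simp add: add_divide_distrib)
  qed
  then show "(\<lambda>n. g \<otimes> x n) \<in> admissible G S d"
    using g admissible_carrier[OF x] unfolding admissible_def by blast
qed

text \<open>By \<open>auto_len_le\<close>, \<open>\<phi> n\<close> stretches lengths by at most the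
  factor \<open>d n\<close>, so after rescaling \<open>\<phi> n g\<close> contributes at most
  \<open>len g\<close>.\<close>

lemma preserves_admissible_paulin:
  assumes \<phi>: "\<And>n. \<phi> n \<in> auto G" and d: "\<And>n s. s \<in> S \<Longrightarrow> real (len (\<phi> n s)) \<le> d n" "\<And>n. 0 \<le> d n"
  shows "preserves_admissible G S d \<phi>"
  unfolding preserves_admissible_def
proof (intro ballI)
  fix g x assume g: "g \<in> carrier G" and x: "x \<in> admissible G S d"
  then obtain C where C: "\<And>n. real (len (x n)) / d n \<le> C" unfolding admissible_def by blast
  have \<phi>g: "\<phi> n g \<in> carrier G" for n using \<phi>[of n] g unfolding auto_def hom_def by auto
  have "real (len (\<phi> n g \<otimes> x n)) / d n \<le> real (len g) + C" for n
  proof -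
    have "real (len (\<phi> n g \<otimes> x n)) \<le> d n * real (len g) + real (len (x n))"
      using len_mult[OF \<phi>g[of n] admissible_carrier[OF x, of n]] auto_len_le[OF \<phi>[of n] d(1) g] by simp
    then have "real (len (\<phi> n g \<otimes> x n)) / d n \<le> (d n * real (len g) + real (len (x n))) / d n"
      using d(2) by (rule divide_right_mono)
    \<comment> \<open>Only an inequality, because the first quotient is 0 when
      \<open>d n = 0\<close>.\<close>
    also have "\<dots> \<le> real (len g) + real (len (x n)) / d n"
      by (simp add: add_divide_distrib)
    finally show ?thesis using C[of n] by simp
  qed
  then show "(\<lambda>n. \<phi> n g \<otimes> x n) \<in> admissible G S d"
    using \<phi>g admissible_carrier[OF x] unfolding admissible_def by blast
qed

end

text \<open>\<open>D \<one>\<close> is subadditive and bounded on the finitely many letters, hence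
  at most a multiple of the word length; small word displacements therefore give small
  \<open>D\<close> displacements.\<close>

lemma acylindrically_hyperbolic_rigid_rays:
  assumes "marked_group G S" and "acylindrically_hyperbolic TYPE('x) G"
  obtains f c \<eta> F where "marked_group.rigid_rays G S f c \<eta> F"
proof -
  interpret marked_group G S by fact
  obtain D \<delta> f c \<tau> F m0 where hp: "hyperbolic_pseudometric G D \<delta>" and fc: "f \<in> carrier G" "c \<in> carrier G"
    and "0 < \<tau>" "finite F" and F: "\<forall>k\<in>carrier G. \<forall>m\<ge>m0.
      (\<forall>x\<in>{\<one>\<^bsub>G\<^esub>, f [^]\<^bsub>G\<^esub> m, inv\<^bsub>G\<^esub> (f [^]\<^bsub>G\<^esub> m), c \<otimes>\<^bsub>G\<^esub> f [^]\<^bsub>G\<^esub> m}. D x (k \<otimes>\<^bsub>G\<^esub> x) \<le> \<tau> * real m) \<longrightarrow> k \<in> F"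
    by (rule acylindrically_hyperbolic_rays[OF group_axioms assms(2)])
  interpret hyperbolic_pseudometric G D \<delta> by (rule hp)
  have finite_letters: "finite letters" using finite_S by simp
  define K where "K = (\<Sum>s\<in>letters. D \<one>\<^bsub>G\<^esub> s)"
  have letter: "D \<one>\<^bsub>G\<^esub> s \<le> K" if s: "s \<in> letters" for s
    unfolding K_def using s finite_letters letters_carrier by (intro member_le_sum D_nonneg) auto
  have K0: "0 \<le> K" unfolding K_def using letters_carrier by (intro sum_nonneg D_nonneg) auto
  have D_le: "D \<one>\<^bsub>G\<^esub> x \<le> K * real (len x)" if x: "x \<in> carrier G" for x
  proof (rule subadditive_le_len[where l = "D \<one>\<^bsub>G\<^esub>", OF _ _ letter x])
    show "D \<one>\<^bsub>G\<^esub> (x \<otimes>\<^bsub>G\<^esub> y) \<le> D \<one>\<^bsub>G\<^esub> x + D \<one>\<^bsub>G\<^esub> y" if "x \<in> carrier G" "y \<in> carrier G" for x y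
      using D_triangle[of "\<one>\<^bsub>G\<^esub>" x "x \<otimes>\<^bsub>G\<^esub> y"] D_left[of x "\<one>\<^bsub>G\<^esub>" y] that by simp
  qed (simp add: D_self)
  \<comment> \<open>The summand 1 keeps the denominator positive when \<open>K = 0\<close>.\<close>
  define \<eta> where "\<eta> = \<tau> / (K + 1)"
  have \<eta>: "0 < \<eta>" "K * \<eta> \<le> \<tau>" using \<open>0 < \<tau>\<close> K0 by (auto simp: \<eta>_def field_simps)
  have small: "D x (k \<otimes>\<^bsub>G\<^esub> x) \<le> \<tau> * real m"
    if "x \<in> carrier G" "k \<in> carrier G" "real (len (inv\<^bsub>G\<^esub> x \<otimes>\<^bsub>G\<^esub> k \<otimes>\<^bsub>G\<^esub> x)) \<le> \<eta> * real m" for x k m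
  proof -
    have "D x (k \<otimes>\<^bsub>G\<^esub> x) \<le> K * real (len (inv\<^bsub>G\<^esub> x \<otimes>\<^bsub>G\<^esub> k \<otimes>\<^bsub>G\<^esub> x))"
      using D_conj D_le that(1,2) by simp
    also have "\<dots> \<le> K * (\<eta> * real m)" using that(3) K0 by (rule mult_left_mono)
    also have "\<dots> \<le> \<tau> * real m" using mult_right_mono[OF \<eta>(2), of "real m"] by (simp add: mult.assoc)
    finally show ?thesis .
  qed
  have "\<forall>k\<in>carrier G. \<forall>m\<ge>m0.
      (\<forall>x\<in>{\<one>\<^bsub>G\<^esub>, f [^]\<^bsub>G\<^esub> m, inv\<^bsub>G\<^esub> (f [^]\<^bsub>G\<^esub> m), c \<otimes>\<^bsub>G\<^esub> f [^]\<^bsub>G\<^esub> m}.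
        real (len (inv\<^bsub>G\<^esub> x \<otimes>\<^bsub>G\<^esub> k \<otimes>\<^bsub>G\<^esub> x)) \<le> \<eta> * real m) \<longrightarrow> k \<in> F"
  proof (intro ballI allI impI)
    fix k m assume k: "k \<in> carrier G" and m: "m0 \<le> m"
      and s: "\<forall>x\<in>{\<one>\<^bsub>G\<^esub>, f [^]\<^bsub>G\<^esub> m, inv\<^bsub>G\<^esub> (f [^]\<^bsub>G\<^esub> m), c \<otimes>\<^bsub>G\<^esub> f [^]\<^bsub>G\<^esub> m}.
        real (len (inv\<^bsub>G\<^esub> x \<otimes>\<^bsub>G\<^esub> k \<otimes>\<^bsub>G\<^esub> x)) \<le> \<eta> * real m"
    have "{\<one>\<^bsub>G\<^esub>, f [^]\<^bsub>G\<^esub> m, inv\<^bsub>G\<^esub> (f [^]\<^bsub>G\<^esub> m), c \<otimes>\<^bsub>G\<^esub> f [^]\<^bsub>G\<^esub> m} \<subseteq> carrier G" using fc by simp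
    then have "\<forall>x\<in>{\<one>\<^bsub>G\<^esub>, f [^]\<^bsub>G\<^esub> m, inv\<^bsub>G\<^esub> (f [^]\<^bsub>G\<^esub> m), c \<otimes>\<^bsub>G\<^esub> f [^]\<^bsub>G\<^esub> m}. D x (k \<otimes>\<^bsub>G\<^esub> x) \<le> \<tau> * real m"
      using s small[OF _ k] by blast
    then show "k \<in> F" using F k m by blast
  qed
  then have "rigid_rays f c \<eta> F"
    unfolding rigid_rays_def using fc \<eta>(1) \<open>finite F\<close> by blast
  with that show thesis .
qed

theorem theorem1p7:
  fixes G :: "('a, 'm) monoid_scheme" and S :: "'a set" and c :: "nat \<Rightarrow> ('a \<Rightarrow> 'a) set"
  assumes "group G"
    and "finite S" and "S \<subseteq> carrier G" and "generate G S = carrier G"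
    and "acylindrically_hyperbolic TYPE('x) G"
    and "infinite (carrier (Out G))"
    and "\<And>n. c n \<in> carrier (Out G)"
    and "\<And>i j. i \<noteq> j \<Longrightarrow> c i \<noteq> c j"
  shows "\<exists>\<phi>. (\<forall>n. \<phi> n \<in> auto G \<and> out_class G (\<phi> n) = c n) \<and>
             preserves_admissible G S (\<lambda>n. paulin_scale G S (\<phi> n)) \<phi> \<and>
             (\<forall>\<omega> d. nonprincipal_ultrafilter \<omega> \<and>
                    (\<forall>n. 0 < d n) \<and> incseq d \<and> \<not> bdd_above (range d) \<longrightarrow>
                    natural_kernel G S \<omega> d = paulin_kernel G S \<omega> \<phi>)"
proof -
  interpret group G by fact
  interpret marked_group G S by unfold_locales fact+
  obtain f h \<eta> F where rigid: "rigid_rays f h \<eta> F"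
    by (rule acylindrically_hyperbolic_rigid_rays[OF marked_group_axioms assms(5)])
  have "\<forall>n. \<exists>\<phi>. \<phi> \<in> auto G \<and> out_class G \<phi> = c n \<and> (\<forall>s\<in>S. real (len (\<phi> s)) \<le> paulin_scale G S \<phi>)"
    using ex_minimal_representative[OF assms(7)] by blast
  then obtain \<phi> where \<phi>: "\<And>n. \<phi> n \<in> auto G" "\<And>n. out_class G (\<phi> n) = c n"
    and min: "\<And>n s. s \<in> S \<Longrightarrow> real (len (\<phi> n s)) \<le> paulin_scale G S (\<phi> n)" by metis
  let ?scale = "\<lambda>n. paulin_scale G S (\<phi> n)"
  have inj: "inj \<phi>" using \<phi>(2) assms(8) by (metis injI)
  \<comment> \<open>For empty \<open>S\<close> every index would satisfy the length bound vacuously,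
    against \<open>finite_bounded_automorphisms\<close>.\<close>
  have "S \<noteq> {}"
  proof
    assume "S = {}"
    then have "{i::nat. \<forall>s\<in>S. len (\<phi> i s) \<le> 0} = UNIV" by blast
    then show False using finite_bounded_automorphisms[OF \<phi>(1) inj, of 0] by (metis infinite_UNIV_nat)
  qed
  then obtain s where "s \<in> S" by blast
  then have nonneg: "0 \<le> ?scale n" for n using min[of s n] by linarith
  have lim: "filterlim ?scale at_top sequentially"
    unfolding filterlim_at_top
  proof
    fix Z
    \<comment> \<open>By the choice of representatives, a scale below \<open>Z\<close> bounds the
      lengths of all images of generators, which happens for finitely many \<open>n\<close>
      only.\<close>
    have "{n. \<not> Z \<le> ?scale n} \<subseteq> {n. \<forall>s\<in>S. len (\<phi> n s) \<le> nat \<lceil>Z\<rceil>}"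
    proof (intro subsetI CollectI ballI)
      fix n s assume "n \<in> {n. \<not> Z \<le> ?scale n}" "s \<in> S"
      then have "real (len (\<phi> n s)) < Z" using min[of s n] by simp
      then show "len (\<phi> n s) \<le> nat \<lceil>Z\<rceil>" by linarith
    qed
    then have "finite {n. \<not> Z \<le> ?scale n}"
      using finite_bounded_automorphisms[OF \<phi>(1) inj] finite_subset by blast
    then show "\<forall>\<^sub>F n in sequentially. Z \<le> ?scale n"
      unfolding cofinite_eq_sequentially[symmetric] eventually_cofinite .
  qed
  have pres: "preserves_admissible G S ?scale \<phi>"
    by (rule preserves_admissible_paulin[OF \<phi>(1) min nonneg])
  have hom: "\<phi> n \<in> hom G G" "bij_betw (\<phi> n) (carrier G) (carrier G)" for n
    using \<phi>(1)[of n] unfolding auto_def Bij_def by auto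
  have "natural_kernel G S \<omega> d = paulin_kernel G S \<omega> \<phi>"
    if \<omega>: "nonprincipal_ultrafilter \<omega>" and d: "\<And>n. 0 < d n" "incseq d" "\<not> bdd_above (range d)" for \<omega> d
  proof -
    note le = nonprincipal_ultrafilter_le_sequentially[OF \<omega>]
    have "\<omega> \<noteq> bot" using \<omega> unfolding nonprincipal_ultrafilter_def by blast
    \<comment> \<open>The natural action is the case of constant identity automorphisms, so one
      lemma computes both kernels.\<close>
    have "natural_kernel G S \<omega> d = FC_center"
    proof (rule cone_kernel_eq_FC_center[OF _ _ \<open>\<omega> \<noteq> bot\<close> _ _ _ rigid])
      show "filterlim d at_top \<omega>"
        using incseq_unbounded_at_top[OF d(2,3)] le by (rule filterlim_mono[OF _ order_refl])
      show "preserves_admissible G S d (\<lambda>n g. g)" by (rule preserves_admissible_natural[OF d(1,2)])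
    qed (use d(1) in \<open>auto simp: hom_def bij_betw_def intro: less_imp_le\<close>)
    also have "FC_center = paulin_kernel G S \<omega> \<phi>"
    proof (rule cone_kernel_eq_FC_center[OF nonneg _ \<open>\<omega> \<noteq> bot\<close> hom pres rigid, symmetric])
      show "filterlim ?scale at_top \<omega>" using lim le by (rule filterlim_mono[OF _ order_refl])
    qed
    finally show ?thesis .
  qed
  then have "\<forall>\<omega> d. nonprincipal_ultrafilter \<omega> \<and> (\<forall>n. 0 < d n) \<and> incseq d \<and> \<not> bdd_above (range d) \<longrightarrow>
      natural_kernel G S \<omega> d = paulin_kernel G S \<omega> \<phi>" by simp
  with \<phi> pres show ?thesis by (intro exI[of _ \<phi>] conjI allI) simp_all
qed

end
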